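(* Let $M^3$ be a 3-dimensional paracontact metric manifold with paracontact metric structure $(\varphi,\xi,\eta,g)$ such that $Q\varphi=\varphi Q$, where $Q$ is the Ricci operator. Then $M^3$ is locally $\varphi$-symmetric if and only if the scalar curvature $\mathrm{scal}$ of $M^3$ is constant.
   Context: An almost paracontact structure on a smooth $(2n+1)$-manifold $M$ is a triple $(\varphi,\xi,\eta)$ of a $(1,1)$-tensor field, a vector field and a 1-form with $\varphi\xi=0$, $\eta\circ\varphi=0$, $\eta(\xi)=1$, $\varphi^2=\mathrm{id}-\eta\otimes\xi$, and such that $\varphi$ induces an almost paracomplex structure on the distribution $\mathbb D=\ker\eta$ (its $\pm1$-eigendistributions in $\mathbb D$ have equal rank $n$). A compatible metric is a pseudo-Riemannian metric $g$ with $g(\varphi X,\varphi Y)=-g(X,Y)+\eta(X)\eta(Y)$; it has signature $(n+1,n)$ and $\eta(X)=g(X,\xi)$. The structure $(\varphi,\xi,\eta,g)$ is a paracontact metric structure, and $M$ a paracontact metric manifold, if in addition $g(X,\varphi Y)=d\eta(X,Y)$, where $d\eta(X,Y)=\frac12\big(X\eta(Y)-Y\eta(X)-\eta([X,Y])\big)$. Here $n=1$. Notation: $\nabla$ is the Levi-Civita connection of $g$; $R(X,Y)Z=\nabla_X\nabla_YZ-\nabla_Y\nabla_XZ-\nabla_{[X,Y]}Z$; $\mathrm{Ric}(Y,Z)$ is the trace of $X\mapsto R(X,Y)Z$; $Q$ is defined by $g(QX,Y)=\mathrm{Ric}(X,Y)$; $\mathrm{scal}=\mathrm{tr}\,Q$.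 A paracontact metric structure is locally $\varphi$-symmetric if $\varphi^2\big((\nabla_WR)(X,Y,Z)\big)=0$ for all vector fields $W,X,Y,Z$ orthogonal to $\xi$, where $(\nabla_WR)(X,Y,Z)$ denotes $(\nabla_WR)(X,Y)Z$.
   Formalization: The manifold M is assumed connected; without this, a disjoint union of two locally φ-symmetric examples with different constant scalar curvatures is locally φ-symmetric although scal is not constant. *)

theory Defs
  imports "HOL-Analysis.Analysis" "HOL-Library.Function_Algebras"
begin

(* The pointwise vector space structure on functions; it makes "span", "dim",
   "representation" available for tangent vectors, which are functionals below. *)

instantiation "fun" :: (type, real_vector) real_vector
begin

definition scaleR_fun :: "real \<Rightarrow> ('a \<Rightarrow> 'b) \<Rightarrow> 'a \<Rightarrow> 'b"
  where "scaleR_fun c f = (\<lambda>x. c *\<^sub>R f x)"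

instance
  by standard (simp_all add: scaleR_fun_def fun_eq_iff scaleR_add_right scaleR_add_left)

end


section \<open>Smooth manifolds\<close>

(* The sets S are open in all uses. *)

primrec higher_differentiable_on ::
  "'a::real_normed_vector set \<Rightarrow> ('a \<Rightarrow> 'b::real_normed_vector) \<Rightarrow> nat \<Rightarrow> bool"
  where
    "higher_differentiable_on S f 0 \<longleftrightarrow> continuous_on S f"
  | "higher_differentiable_on S f (Suc k) \<longleftrightarrow>
      (\<forall>x\<in>S. f differentiable (at x)) \<and>
      (\<forall>v. higher_differentiable_on S (\<lambda>x. frechet_derivative f (at x) v) k)"

definition smooth_on :: "'a::real_normed_vector set \<Rightarrow> ('a \<Rightarrow> 'b::real_normed_vector) \<Rightarrow> bool"
  where "smooth_on S f \<longleftrightarrow> (\<forall>k. higher_differentiable_on S f k)"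

(* A chart is a pair of its domain and its coordinate map. The underlying set of the manifold
   is the whole type 'm; the manifold topology is the one of the type. *)

type_synonym ('m, 'e) chart = "'m set \<times> ('m \<Rightarrow> 'e)"

definition smooth_atlas :: "('m::topological_space, 'e::euclidean_space) chart set \<Rightarrow> bool"
  where "smooth_atlas \<A> \<longleftrightarrow>
    (\<Union>(U, c)\<in>\<A>. U) = UNIV \<and>
    (\<forall>(U, c)\<in>\<A>. open U \<and> open (c ` U) \<and> homeomorphism U (c ` U) c (inv_into U c)) \<and>
    (\<forall>(U, c)\<in>\<A>. \<forall>(V, d)\<in>\<A>. smooth_on (c ` (U \<inter> V)) (d \<circ> inv_into U c))"

definition smooth_functions ::
  "('m::topological_space, 'e::euclidean_space) chart set \<Rightarrow> ('m \<Rightarrow> real) set"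
  where "smooth_functions \<A> = {f. \<forall>(U, c)\<in>\<A>. smooth_on (c ` U) (f \<circ> inv_into U c)}"


section \<open>Tangent vectors and vector fields\<close>

type_synonym 'm tvec = "('m \<Rightarrow> real) \<Rightarrow> real"
type_synonym 'm vfield = "'m \<Rightarrow> 'm tvec"

(* Derivations at p of the algebra of smooth functions. The functionals live on all functions,
   so they are normalised to 0 outside the smooth ones to make equality meaningful. *)

definition tangent_space ::
  "('m::topological_space, 'e::euclidean_space) chart set \<Rightarrow> 'm \<Rightarrow> 'm tvec set"
  where "tangent_space \<A> p = {v.
    (\<forall>f\<in>smooth_functions \<A>. \<forall>h\<in>smooth_functions \<A>.
        v (\<lambda>q. f q + h q) = v f + v h \<and>
        v (\<lambda>q. f q * h q) = f p * v h + h p * v f) \<and>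
    (\<forall>f\<in>smooth_functions \<A>. \<forall>a. v (\<lambda>q. a * f q) = a * v f) \<and>
    (\<forall>f. f \<notin> smooth_functions \<A> \<longrightarrow> v f = 0)}"

definition vector_fields ::
  "('m::topological_space, 'e::euclidean_space) chart set \<Rightarrow> 'm vfield set"
  where "vector_fields \<A> = {X.
    (\<forall>p. X p \<in> tangent_space \<A> p) \<and>
    (\<forall>f\<in>smooth_functions \<A>. (\<lambda>p. X p f) \<in> smooth_functions \<A>)}"

definition lie_bracket :: "'m vfield \<Rightarrow> 'm vfield \<Rightarrow> 'm vfield"
  where "lie_bracket X Y = (\<lambda>p f. X p (\<lambda>q. Y q f) - Y p (\<lambda>q. X q f))"


section \<open>Tensor fields\<close>

(* Tensor fields are families of multilinear maps on tangent spaces; only their values on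
   tangent vectors matter. Smoothness is tested on smooth vector fields. *)

definition tensor_field_1_1 ::
  "('m::topological_space, 'e::euclidean_space) chart set \<Rightarrow> ('m \<Rightarrow> 'm tvec \<Rightarrow> 'm tvec) \<Rightarrow> bool"
  where "tensor_field_1_1 \<A> L \<longleftrightarrow>
    (\<forall>p. \<forall>x\<in>tangent_space \<A> p. L p x \<in> tangent_space \<A> p \<and>
        (\<forall>y\<in>tangent_space \<A> p. L p (x + y) = L p x + L p y) \<and>
        (\<forall>a. L p (a *\<^sub>R x) = a *\<^sub>R L p x)) \<and>
    (\<forall>X\<in>vector_fields \<A>. (\<lambda>p. L p (X p)) \<in> vector_fields \<A>)"

definition one_form ::
  "('m::topological_space, 'e::euclidean_space) chart set \<Rightarrow> ('m \<Rightarrow> 'm tvec \<Rightarrow> real) \<Rightarrow> bool"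
  where "one_form \<A> \<omega> \<longleftrightarrow>
    (\<forall>p. \<forall>x\<in>tangent_space \<A> p.
        (\<forall>y\<in>tangent_space \<A> p. \<omega> p (x + y) = \<omega> p x + \<omega> p y) \<and>
        (\<forall>a. \<omega> p (a *\<^sub>R x) = a * \<omega> p x)) \<and>
    (\<forall>X\<in>vector_fields \<A>. (\<lambda>p. \<omega> p (X p)) \<in> smooth_functions \<A>)"

definition pseudo_riemannian_metric ::
  "('m::topological_space, 'e::euclidean_space) chart set \<Rightarrow>
    ('m \<Rightarrow> 'm tvec \<Rightarrow> 'm tvec \<Rightarrow> real) \<Rightarrow> bool"
  where "pseudo_riemannian_metric \<A> g \<longleftrightarrow>
    (\<forall>p. \<forall>x\<in>tangent_space \<A> p. \<forall>y\<in>tangent_space \<A> p.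
        g p x y = g p y x \<and>
        (\<forall>z\<in>tangent_space \<A> p. g p (x + z) y = g p x y + g p z y) \<and>
        (\<forall>a. g p (a *\<^sub>R x) y = a * g p x y)) \<and>
    (\<forall>p. \<forall>x\<in>tangent_space \<A> p. (\<forall>y\<in>tangent_space \<A> p. g p x y = 0) \<longrightarrow> x = 0) \<and>
    (\<forall>X\<in>vector_fields \<A>. \<forall>Y\<in>vector_fields \<A>. (\<lambda>p. g p (X p) (Y p)) \<in> smooth_functions \<A>)"

definition exterior_derivative ::
  "('m \<Rightarrow> 'm tvec \<Rightarrow> real) \<Rightarrow> 'm vfield \<Rightarrow> 'm vfield \<Rightarrow> 'm \<Rightarrow> real"
  where "exterior_derivative \<omega> X Y p =
    (X p (\<lambda>q. \<omega> q (Y q)) - Y p (\<lambda>q. \<omega> q (X q)) - \<omega> p (lie_bracket X Y p)) / 2"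


section \<open>Levi-Civita connection and curvature\<close>

definition affine_connection ::
  "('m::topological_space, 'e::euclidean_space) chart set \<Rightarrow>
    ('m vfield \<Rightarrow> 'm vfield \<Rightarrow> 'm vfield) \<Rightarrow> bool"
  where "affine_connection \<A> D \<longleftrightarrow>
    (\<forall>X\<in>vector_fields \<A>. \<forall>Y\<in>vector_fields \<A>.
        D X Y \<in> vector_fields \<A> \<and>
        (\<forall>Z\<in>vector_fields \<A>.
            D (X + Z) Y = D X Y + D Z Y \<and> D X (Y + Z) = D X Y + D X Z) \<and>
        (\<forall>f\<in>smooth_functions \<A>.
            D (\<lambda>p. f p *\<^sub>R X p) Y = (\<lambda>p. f p *\<^sub>R D X Y p) \<and>
            D X (\<lambda>p. f p *\<^sub>R Y p) = (\<lambda>p. X p f *\<^sub>R Y p + f p *\<^sub>R D X Y p)))"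

definition levi_civita_connection ::
  "('m::topological_space, 'e::euclidean_space) chart set \<Rightarrow>
    ('m \<Rightarrow> 'm tvec \<Rightarrow> 'm tvec \<Rightarrow> real) \<Rightarrow> ('m vfield \<Rightarrow> 'm vfield \<Rightarrow> 'm vfield) \<Rightarrow> bool"
  where "levi_civita_connection \<A> g D \<longleftrightarrow>
    affine_connection \<A> D \<and>
    (\<forall>X\<in>vector_fields \<A>. \<forall>Y\<in>vector_fields \<A>. D X Y - D Y X = lie_bracket X Y) \<and>
    (\<forall>X\<in>vector_fields \<A>. \<forall>Y\<in>vector_fields \<A>. \<forall>Z\<in>vector_fields \<A>. \<forall>p.
        X p (\<lambda>q. g q (Y q) (Z q)) = g p (D X Y p) (Z p) + g p (Y p) (D X Z p))"

definition curvature ::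
  "('m vfield \<Rightarrow> 'm vfield \<Rightarrow> 'm vfield) \<Rightarrow> 'm vfield \<Rightarrow> 'm vfield \<Rightarrow> 'm vfield \<Rightarrow> 'm vfield"
  where "curvature D X Y Z = D X (D Y Z) - D Y (D X Z) - D (lie_bracket X Y) Z"

definition cov_deriv_curvature ::
  "('m vfield \<Rightarrow> 'm vfield \<Rightarrow> 'm vfield) \<Rightarrow>
    'm vfield \<Rightarrow> 'm vfield \<Rightarrow> 'm vfield \<Rightarrow> 'm vfield \<Rightarrow> 'm vfield"
  where "cov_deriv_curvature D W X Y Z =
    D W (curvature D X Y Z) - curvature D (D W X) Y Z
      - curvature D X (D W Y) Z - curvature D X Y (D W Z)"

(* The curvature is tensorial, hence its value at p does not depend on the chosen extensions
   of the tangent vectors at p. *)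

definition extension ::
  "('m::topological_space, 'e::euclidean_space) chart set \<Rightarrow> 'm \<Rightarrow> 'm tvec \<Rightarrow> 'm vfield"
  where "extension \<A> p x = (SOME X. X \<in> vector_fields \<A> \<and> X p = x)"

definition curvature_at ::
  "('m::topological_space, 'e::euclidean_space) chart set \<Rightarrow>
    ('m vfield \<Rightarrow> 'm vfield \<Rightarrow> 'm vfield) \<Rightarrow> 'm \<Rightarrow> 'm tvec \<Rightarrow> 'm tvec \<Rightarrow> 'm tvec \<Rightarrow> 'm tvec"
  where "curvature_at \<A> D p x y z =
    curvature D (extension \<A> p x) (extension \<A> p y) (extension \<A> p z) p"

(* The trace of a linear endomorphism L of a finite-dimensional subspace V, computed in some
   basis of V. *)

definition trace_on :: "'v::real_vector set \<Rightarrow> ('v \<Rightarrow> 'v) \<Rightarrow> real"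
  where "trace_on V L =
    (let B = (SOME B. independent B \<and> span B = V) in \<Sum>b\<in>B. representation B (L b) b)"

definition ricci ::
  "('m::topological_space, 'e::euclidean_space) chart set \<Rightarrow>
    ('m vfield \<Rightarrow> 'm vfield \<Rightarrow> 'm vfield) \<Rightarrow> 'm \<Rightarrow> 'm tvec \<Rightarrow> 'm tvec \<Rightarrow> real"
  where "ricci \<A> D p y z = trace_on (tangent_space \<A> p) (\<lambda>x. curvature_at \<A> D p x y z)"

definition ricci_operator ::
  "('m::topological_space, 'e::euclidean_space) chart set \<Rightarrow>
    ('m \<Rightarrow> 'm tvec \<Rightarrow> 'm tvec \<Rightarrow> real) \<Rightarrow> ('m vfield \<Rightarrow> 'm vfield \<Rightarrow> 'm vfield) \<Rightarrow>
    'm \<Rightarrow> 'm tvec \<Rightarrow> 'm tvec"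
  where "ricci_operator \<A> g D p x =
    (THE q. q \<in> tangent_space \<A> p \<and> (\<forall>y\<in>tangent_space \<A> p. g p q y = ricci \<A> D p x y))"

definition scalar_curvature ::
  "('m::topological_space, 'e::euclidean_space) chart set \<Rightarrow>
    ('m \<Rightarrow> 'm tvec \<Rightarrow> 'm tvec \<Rightarrow> real) \<Rightarrow> ('m vfield \<Rightarrow> 'm vfield \<Rightarrow> 'm vfield) \<Rightarrow> 'm \<Rightarrow> real"
  where "scalar_curvature \<A> g D p = trace_on (tangent_space \<A> p) (ricci_operator \<A> g D p)"


section \<open>Paracontact metric structures\<close>

definition almost_paracontact_structure ::
  "nat \<Rightarrow> ('m::topological_space, 'e::euclidean_space) chart set \<Rightarrow>
    ('m \<Rightarrow> 'm tvec \<Rightarrow> 'm tvec) \<Rightarrow> 'm vfield \<Rightarrow> ('m \<Rightarrow> 'm tvec \<Rightarrow> real) \<Rightarrow> bool"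
  where "almost_paracontact_structure n \<A> \<phi> \<xi> \<eta> \<longleftrightarrow>
    DIM('e) = 2 * n + 1 \<and>
    tensor_field_1_1 \<A> \<phi> \<and> \<xi> \<in> vector_fields \<A> \<and> one_form \<A> \<eta> \<and>
    (\<forall>p. \<phi> p (\<xi> p) = 0 \<and> \<eta> p (\<xi> p) = 1) \<and>
    (\<forall>p. \<forall>x\<in>tangent_space \<A> p. \<eta> p (\<phi> p x) = 0 \<and> \<phi> p (\<phi> p x) = x - \<eta> p x *\<^sub>R \<xi> p) \<and>
    (\<forall>p. dim {x\<in>tangent_space \<A> p. \<eta> p x = 0 \<and> \<phi> p x = x} = n \<and>
         dim {x\<in>tangent_space \<A> p. \<eta> p x = 0 \<and> \<phi> p x = - x} = n)"

definition compatible_metric ::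
  "('m::topological_space, 'e::euclidean_space) chart set \<Rightarrow>
    ('m \<Rightarrow> 'm tvec \<Rightarrow> 'm tvec) \<Rightarrow> ('m \<Rightarrow> 'm tvec \<Rightarrow> real) \<Rightarrow>
    ('m \<Rightarrow> 'm tvec \<Rightarrow> 'm tvec \<Rightarrow> real) \<Rightarrow> bool"
  where "compatible_metric \<A> \<phi> \<eta> g \<longleftrightarrow>
    pseudo_riemannian_metric \<A> g \<and>
    (\<forall>p. \<forall>x\<in>tangent_space \<A> p. \<forall>y\<in>tangent_space \<A> p.
        g p (\<phi> p x) (\<phi> p y) = - g p x y + \<eta> p x * \<eta> p y)"

definition paracontact_metric_structure ::
  "nat \<Rightarrow> ('m::topological_space, 'e::euclidean_space) chart set \<Rightarrow>
    ('m \<Rightarrow> 'm tvec \<Rightarrow> 'm tvec) \<Rightarrow> 'm vfield \<Rightarrow> ('m \<Rightarrow> 'm tvec \<Rightarrow> real) \<Rightarrow>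
    ('m \<Rightarrow> 'm tvec \<Rightarrow> 'm tvec \<Rightarrow> real) \<Rightarrow> bool"
  where "paracontact_metric_structure n \<A> \<phi> \<xi> \<eta> g \<longleftrightarrow>
    almost_paracontact_structure n \<A> \<phi> \<xi> \<eta> \<and> compatible_metric \<A> \<phi> \<eta> g \<and>
    (\<forall>X\<in>vector_fields \<A>. \<forall>Y\<in>vector_fields \<A>. \<forall>p.
        g p (X p) (\<phi> p (Y p)) = exterior_derivative \<eta> X Y p)"

definition locally_phi_symmetric ::
  "('m::topological_space, 'e::euclidean_space) chart set \<Rightarrow>
    ('m \<Rightarrow> 'm tvec \<Rightarrow> 'm tvec) \<Rightarrow> 'm vfield \<Rightarrow> ('m \<Rightarrow> 'm tvec \<Rightarrow> 'm tvec \<Rightarrow> real) \<Rightarrow>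
    ('m vfield \<Rightarrow> 'm vfield \<Rightarrow> 'm vfield) \<Rightarrow> bool"
  where "locally_phi_symmetric \<A> \<phi> \<xi> g D \<longleftrightarrow>
    (\<forall>W\<in>vector_fields \<A>. \<forall>X\<in>vector_fields \<A>. \<forall>Y\<in>vector_fields \<A>. \<forall>Z\<in>vector_fields \<A>.
        (\<forall>p. g p (W p) (\<xi> p) = 0 \<and> g p (X p) (\<xi> p) = 0 \<and>
             g p (Y p) (\<xi> p) = 0 \<and> g p (Z p) (\<xi> p) = 0) \<longrightarrow>
        (\<forall>p. \<phi> p (\<phi> p (cov_deriv_curvature D W X Y Z p)) = 0))"

end

(* In dimension 3, Q phi = phi Q forces Q to be a multiple of the identity on ker eta, so with
   kappa = Ric(xi, xi) / 2 and tau = scal / 2 - 2 kappa the curvature is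
   R = tau T + (kappa - tau) T', where T(X, Y) Z = g(Y, Z) X - g(X, Z) Y and T' involves eta.
   The second Bianchi identity on xi, P, N, for a null frame P, N of the eigenlines of phi,
   together with D xi xi = 0, gives d kappa = 0 on ker eta.  For horizontal arguments
   phi^2 (D_W R)(X, Y) Z = W(tau) T(X, Y) Z, so local phi-symmetry means d tau = 0 on ker eta.
   As ker eta is bracket generating, vanishing on ker eta may be replaced by vanishing, and
   scal = 2 tau + 4 kappa.

   No local frames are needed: the identity
   g(P, N) X = g(P, N) eta(X) xi + g(X, N) P + g(X, P) N holds everywhere, also where P or N
   vanishes, and shows that the curvature is tensorial. *)

theory Submission
  imports Defs
begin

section \<open>Calculus of smooth functions and bump functions\<close>

text \<open>\<open>curvature_at\<close>, \<open>trace_on\<close> and \<open>ricci_operator\<close>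
  rest on choices (of extensions, of a basis, of the vector described by \<open>THE\<close>), so
  none can be computed before every tangent vector is known to extend to a global field. Tangent
  vectors are derivations of global functions, so bump functions must carry coordinate fields to the
  manifold. That these fields span the tangent space would usually follow from the Taylor formula
  for derivations; here the structure itself bounds the dimension, since \<xi> and the two
  eigenlines of \<phi> span, and three independent coordinate fields then fill the space.

  Commutation enters through the eigenlines: \<open>Q\<close> preserves them, and they are null and
  orthogonal to \<xi>, so certain Ricci components vanish; in dimension 3 each of these is, up to a
  factor, a single component of the curvature. As the derivative of \<kappa> always vanishes, both
  sides of the equivalence speak of the derivative of \<tau>, and connectedness turns a vanishing
  derivative into constancy.\<close>

lemma higher_differentiable_on_mono:
  "higher_differentiable_on S f k \<Longrightarrow> T \<subseteq> S \<Longrightarrow> higher_differentiable_on T f k"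
  by (induction k arbitrary: f) (auto intro: continuous_on_subset)

lemma higher_differentiable_on_cong:
  assumes "open S" "\<And>x. x \<in> S \<Longrightarrow> f x = h x" "higher_differentiable_on S f k"
  shows "higher_differentiable_on S h k"
  using assms(2,3)
proof (induction k arbitrary: f h)
  case 0
  then show ?case using continuous_on_cong by fastforce
next
  case (Suc k)
  have d: "(h has_derivative frechet_derivative f (at x)) (at x)" if "x \<in> S" for x
  proof (rule has_derivative_transform_within_open[OF _ \<open>open S\<close> that])
    show "(f has_derivative frechet_derivative f (at x)) (at x)"
      using Suc.prems(2) that by (simp add: frechet_derivative_works)
  qed (use Suc.prems in auto)
  have e: "frechet_derivative f (at x) = frechet_derivative h (at x)" if "x \<in> S" for x
    using frechet_derivative_at[OF d[OF that]] .
  show ?case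
    unfolding higher_differentiable_on.simps
  proof (intro conjI ballI allI)
    show "h differentiable at x" if "x \<in> S" for x
      using d[OF that] by (auto simp: differentiable_def)
    show "higher_differentiable_on S (\<lambda>x. frechet_derivative h (at x) v) k" for v
      by (rule Suc.IH[of "\<lambda>x. frechet_derivative f (at x) v"]) (use Suc.prems e in auto)
  qed
qed

lemma higher_differentiable_on_SucD:
  "higher_differentiable_on S f (Suc k) \<Longrightarrow> higher_differentiable_on S f k"
proof (induction k arbitrary: f)
  case 0
  then show ?case
    by (auto intro!: continuous_at_imp_continuous_on differentiable_imp_continuous_within)
next
  case (Suc k)
  then show ?case
    by (metis higher_differentiable_on.simps(2))
qed

lemma higher_differentiable_on_local:
  assumes "\<And>x. x \<in> S \<Longrightarrow> \<exists>T. open T \<and> x \<in> T \<and> higher_differentiable_on T f k"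
  shows "higher_differentiable_on S f k"
  using assms
proof (induction k arbitrary: f)
  case 0
  show ?case
    unfolding higher_differentiable_on.simps
  proof (intro continuous_at_imp_continuous_on ballI)
    fix x assume "x \<in> S"
    then show "isCont f x"
      using 0[of x] by (auto simp: continuous_on_eq_continuous_at)
  qed
next
  case (Suc k)
  show ?case
    unfolding higher_differentiable_on.simps
  proof (intro conjI ballI allI)
    show "f differentiable at x" if "x \<in> S" for x
      using Suc.prems[OF that] by auto
    show "higher_differentiable_on S (\<lambda>x. frechet_derivative f (at x) v) k" for v
      by (rule Suc.IH) (use Suc.prems in fastforce)
  qed
qed

text \<open>Lets an explicit formula \<open>f'\<close> stand for \<open>frechet_derivative\<close>,
  so that the rules for products, inverses and compositions become inductions on the order.\<close>

lemma higher_differentiable_on_SucI: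
  assumes "open S"
    and "\<And>x. x \<in> S \<Longrightarrow> (f has_derivative f' x) (at x)"
    and "\<And>v. higher_differentiable_on S (\<lambda>x. f' x v) k"
  shows "higher_differentiable_on S f (Suc k)"
  unfolding higher_differentiable_on.simps
proof (intro conjI ballI allI)
  show "f differentiable at x" if "x \<in> S" for x
    using assms(2)[OF that] by (auto simp: differentiable_def)
  show "higher_differentiable_on S (\<lambda>x. frechet_derivative f (at x) v) k" for v
    by (rule higher_differentiable_on_cong[OF \<open>open S\<close> _ assms(3)[of v]])
      (simp add: frechet_derivative_at[OF assms(2)])
qed

lemma higher_differentiable_on_SucE:
  assumes "higher_differentiable_on S f (Suc k)"
  shows "\<And>x. x \<in> S \<Longrightarrow> (f has_derivative frechet_derivative f (at x)) (at x)"
    and "\<And>v. higher_differentiable_on S (\<lambda>x. frechet_derivative f (at x) v) k"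
    and "higher_differentiable_on S f k"
  using assms higher_differentiable_on_SucD[OF assms] by (auto simp: frechet_derivative_works)

lemma higher_differentiable_on_const: "open S \<Longrightarrow> higher_differentiable_on S (\<lambda>x. a) k"
proof (induction k arbitrary: a)
  case (Suc k)
  show ?case
    by (rule higher_differentiable_on_SucI[where f' = "\<lambda>x v. 0"]) (use Suc in auto)
qed auto

lemma higher_differentiable_on_bounded_linear:
  assumes "open S" "bounded_linear f"
  shows "higher_differentiable_on S f k"
proof (cases k)
  case 0
  then show ?thesis
    using assms linear_continuous_on by auto
next
  case (Suc l)
  show ?thesis unfolding Suc
    by (rule higher_differentiable_on_SucI[where f' = "\<lambda>x. f"])
      (use assms in \<open>auto intro: bounded_linear_imp_has_derivative higher_differentiable_on_const\<close>)
qed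

lemma higher_differentiable_on_add:
  assumes "open S"
  shows "higher_differentiable_on S f k \<Longrightarrow> higher_differentiable_on S h k \<Longrightarrow>
    higher_differentiable_on S (\<lambda>x. f x + h x) k"
proof (induction k arbitrary: f h)
  case 0
  then show ?case by (auto intro: continuous_intros)
next
  case (Suc k)
  note f = higher_differentiable_on_SucE[OF Suc.prems(1)]
  note h = higher_differentiable_on_SucE[OF Suc.prems(2)]
  show ?case
    by (rule higher_differentiable_on_SucI[OF assms has_derivative_add[OF f(1) h(1)]
          Suc.IH[OF f(2) h(2)]])
qed

lemma higher_differentiable_on_sum:
  assumes "open S" "finite I" "\<And>i. i \<in> I \<Longrightarrow> higher_differentiable_on S (f i) k"
  shows "higher_differentiable_on S (\<lambda>x. \<Sum>i\<in>I. f i x) k"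
  using assms(2,3)
  by (induction I) (auto intro: higher_differentiable_on_const higher_differentiable_on_add assms(1))

lemma higher_differentiable_on_mult:
  fixes f h :: "'a::real_normed_vector \<Rightarrow> real"
  assumes "open S"
  shows "higher_differentiable_on S f k \<Longrightarrow> higher_differentiable_on S h k \<Longrightarrow>
    higher_differentiable_on S (\<lambda>x. f x * h x) k"
proof (induction k arbitrary: f h)
  case 0
  then show ?case by (auto intro: continuous_intros)
next
  case (Suc k)
  note f = higher_differentiable_on_SucE[OF Suc.prems(1)]
  note h = higher_differentiable_on_SucE[OF Suc.prems(2)]
  show ?case
    by (rule higher_differentiable_on_SucI[OF assms has_derivative_mult[OF f(1) h(1)]])
      (assumption | intro higher_differentiable_on_add assms Suc.IH f h)+
qed

lemma higher_differentiable_on_inverse: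
  fixes f :: "'a::real_normed_vector \<Rightarrow> real"
  assumes "open S" "\<And>x. x \<in> S \<Longrightarrow> f x \<noteq> 0"
  shows "higher_differentiable_on S f k \<Longrightarrow> higher_differentiable_on S (\<lambda>x. inverse (f x)) k"
proof (induction k)
  case 0
  then show ?case using assms by (auto intro!: continuous_intros)
next
  case (Suc k)
  have i: "higher_differentiable_on S (\<lambda>x. inverse (f x)) k"
    using Suc higher_differentiable_on_SucE(3) by blast
  show ?case
  proof (rule higher_differentiable_on_SucI[OF assms(1)])
    fix x assume "x \<in> S"
    \<comment> \<open>Written as a product of real functions so that the product rule of order
      \<open>k\<close> applies, with \<open>i\<close> for the factors
      \<open>inverse (f x)\<close>.\<close>
    show "((\<lambda>x. inverse (f x)) has_derivative
        (\<lambda>v. -1 * (inverse (f x) * frechet_derivative f (at x) v * inverse (f x)))) (at x)"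
      using Deriv.has_derivative_inverse[OF assms(2) higher_differentiable_on_SucE(1)[OF Suc.prems]] \<open>x \<in> S\<close>
      by simp
  qed (intro higher_differentiable_on_mult higher_differentiable_on_const i assms(1)
      higher_differentiable_on_SucE(2)[OF Suc.prems])
qed

text \<open>The chain rule as a finite sum of products with partial derivatives. In this form
  smoothness of a composition reduces to sums and products of real functions, without composing
  functions whose values are linear maps.\<close>

lemma has_derivative_inner_basis_sum:
  fixes f :: "'a::real_normed_vector \<Rightarrow> 'b::euclidean_space"
  assumes "(f has_derivative f') (at x)" "(h has_derivative h') (at (f x))"
  shows "((\<lambda>x. h (f x)) has_derivative (\<lambda>v. \<Sum>b\<in>Basis. (f' v \<bullet> b) *\<^sub>R h' b)) (at x)"
proof -
  have "linear h'"
    using assms(2) has_derivative_linear by blast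
  have *: "h' y = (\<Sum>b\<in>Basis. (y \<bullet> b) *\<^sub>R h' b)" for y
  proof -
    have "h' y = h' (\<Sum>b\<in>Basis. (y \<bullet> b) *\<^sub>R b)"
      by (simp only: euclidean_representation)
    also have "\<dots> = (\<Sum>b\<in>Basis. (y \<bullet> b) *\<^sub>R h' b)"
      using \<open>linear h'\<close> by (simp add: linear_sum linear_cmul)
    finally show ?thesis .
  qed
  show ?thesis
    unfolding *[symmetric] by (rule has_derivative_compose[OF assms])
qed

lemma higher_differentiable_on_inner:
  fixes f :: "'a::real_normed_vector \<Rightarrow> 'b::real_inner"
  assumes "open S"
  shows "higher_differentiable_on S f k \<Longrightarrow> higher_differentiable_on S (\<lambda>x. f x \<bullet> b) k"
proof (induction k arbitrary: f)
  case 0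
  then show ?case by (auto intro: continuous_intros)
next
  case (Suc k)
  note f = higher_differentiable_on_SucE[OF Suc.prems]
  show ?case
    by (rule higher_differentiable_on_SucI[OF assms has_derivative_inner_left[OF f(1)]
          Suc.IH[OF f(2)]])
qed

lemma higher_differentiable_on_compose:
  fixes f :: "'a::real_normed_vector \<Rightarrow> 'b::euclidean_space" and h :: "'b \<Rightarrow> real"
  assumes "open S" "open T" "f ` S \<subseteq> T"
  shows "higher_differentiable_on S f k \<Longrightarrow> higher_differentiable_on T h k \<Longrightarrow>
    higher_differentiable_on S (\<lambda>x. h (f x)) k"
proof (induction k arbitrary: h)
  case 0
  then show ?case using assms(3) continuous_on_compose2 by auto
next
  case (Suc k)
  note f = higher_differentiable_on_SucE[OF Suc.prems(1)]
  note h = higher_differentiable_on_SucE[OF Suc.prems(2)]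
  show ?case
  proof (rule higher_differentiable_on_SucI[OF assms(1)])
    fix x assume "x \<in> S"
    then show "((\<lambda>x. h (f x)) has_derivative (\<lambda>v. \<Sum>b\<in>Basis.
        (frechet_derivative f (at x) v \<bullet> b) * frechet_derivative h (at (f x)) b)) (at x)"
      using has_derivative_inner_basis_sum[OF f(1) h(1)] assms(3) by auto
  next
    show "higher_differentiable_on S (\<lambda>x. \<Sum>b\<in>Basis.
        (frechet_derivative f (at x) v \<bullet> b) * frechet_derivative h (at (f x)) b) k" for v
      by (intro higher_differentiable_on_sum higher_differentiable_on_mult
          higher_differentiable_on_inner Suc.IH f h assms(1) finite_Basis)
  qed
qed

lemma smooth_on_mono: "smooth_on S f \<Longrightarrow> T \<subseteq> S \<Longrightarrow> smooth_on T f"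
  by (auto simp: smooth_on_def intro: higher_differentiable_on_mono)

lemma smooth_on_cong: "open S \<Longrightarrow> smooth_on S f \<Longrightarrow> (\<And>x. x \<in> S \<Longrightarrow> f x = h x) \<Longrightarrow> smooth_on S h"
  unfolding smooth_on_def using higher_differentiable_on_cong by blast

lemma smooth_on_local:
  assumes "\<And>x. x \<in> S \<Longrightarrow> \<exists>T. open T \<and> x \<in> T \<and> smooth_on T f"
  shows "smooth_on S f"
  using assms unfolding smooth_on_def by (meson higher_differentiable_on_local)

lemma smooth_on_const: "open S \<Longrightarrow> smooth_on S (\<lambda>x. a)"
  by (simp add: smooth_on_def higher_differentiable_on_const)

lemma smooth_on_bounded_linear: "open S \<Longrightarrow> bounded_linear f \<Longrightarrow> smooth_on S f"
  by (simp add: smooth_on_def higher_differentiable_on_bounded_linear)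

lemma smooth_on_add: "open S \<Longrightarrow> smooth_on S f \<Longrightarrow> smooth_on S h \<Longrightarrow> smooth_on S (\<lambda>x. f x + h x)"
  by (simp add: smooth_on_def higher_differentiable_on_add)

lemma smooth_on_mult:
  fixes f h :: "'a::real_normed_vector \<Rightarrow> real"
  shows "open S \<Longrightarrow> smooth_on S f \<Longrightarrow> smooth_on S h \<Longrightarrow> smooth_on S (\<lambda>x. f x * h x)"
  by (simp add: smooth_on_def higher_differentiable_on_mult)

lemma smooth_on_sum:
  assumes "open S" "finite I" "\<And>i. i \<in> I \<Longrightarrow> smooth_on S (f i)"
  shows "smooth_on S (\<lambda>x. \<Sum>i\<in>I. f i x)"
  using assms by (simp add: smooth_on_def higher_differentiable_on_sum)

lemma smooth_on_inverse:
  fixes f :: "'a::real_normed_vector \<Rightarrow> real"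
  shows "open S \<Longrightarrow> smooth_on S f \<Longrightarrow> (\<And>x. x \<in> S \<Longrightarrow> f x \<noteq> 0) \<Longrightarrow> smooth_on S (\<lambda>x. inverse (f x))"
  by (simp add: smooth_on_def higher_differentiable_on_inverse)

lemma smooth_on_compose:
  fixes f :: "'a::real_normed_vector \<Rightarrow> 'b::euclidean_space" and h :: "'b \<Rightarrow> real"
  shows "open S \<Longrightarrow> open T \<Longrightarrow> f ` S \<subseteq> T \<Longrightarrow> smooth_on S f \<Longrightarrow> smooth_on T h \<Longrightarrow>
    smooth_on S (\<lambda>x. h (f x))"
  by (simp add: smooth_on_def higher_differentiable_on_compose)

lemma smooth_on_frechet_derivative:
  assumes "smooth_on S f"
  shows "smooth_on S (\<lambda>x. frechet_derivative f (at x) v)"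
  using assms unfolding smooth_on_def by (metis higher_differentiable_on_SucE(2))

lemma smooth_on_imp_has_derivative:
  assumes "smooth_on S f" "x \<in> S"
  shows "(f has_derivative frechet_derivative f (at x)) (at x)"
  using assms unfolding smooth_on_def by (metis higher_differentiable_on_SucE(1))

lemma smooth_on_imp_continuous_on: "smooth_on S f \<Longrightarrow> continuous_on S f"
  unfolding smooth_on_def by (metis higher_differentiable_on.simps(1))

text \<open>The powers of \<open>1/t\<close> make the family closed under differentiation up to linear combinations.\<close>

definition flat_exp :: "nat \<Rightarrow> real \<Rightarrow> real"
  where "flat_exp n t = (if t > 0 then inverse t ^ n * exp (- inverse t) else 0)"

lemma flat_exp_mult: "flat_exp n t = t * flat_exp (Suc n) t"
  by (auto simp: flat_exp_def)

lemma flat_exp_tendsto_0: "(flat_exp n \<longlongrightarrow> 0) (at 0)"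
proof -
  have "((\<lambda>t::real. inverse t ^ n / exp (inverse t)) \<longlongrightarrow> 0) (at_right 0)"
    by (rule filterlim_compose[OF tendsto_power_div_exp_0 filterlim_inverse_at_top_right])
  then have r: "(flat_exp n \<longlongrightarrow> 0) (at_right 0)"
    by (rule Lim_transform_eventually)
      (auto simp: eventually_at_right_field flat_exp_def exp_minus divide_inverse intro!: exI[of _ 1])
  have l: "(flat_exp n \<longlongrightarrow> 0) (at_left 0)"
    by (rule Lim_transform_eventually[OF tendsto_const])
      (auto simp: eventually_at_left_field flat_exp_def intro!: exI[of _ "-1"])
  show ?thesis
    using l r filterlim_split_at by blast
qed

lemma DERIV_flat_exp:
  "(flat_exp n has_real_derivative (- real n * flat_exp (n + 1) t + flat_exp (n + 2) t)) (at t)"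
proof (cases t "0::real" rule: linorder_cases)
  case less
  then have "eventually (\<lambda>x. x < 0) (nhds t)"
    using eventually_nhds_in_open[of "{..<0}" t] by simp
  then have "eventually (\<lambda>x. 0 = flat_exp n x) (nhds t)"
    by (rule eventually_mono) (auto simp: flat_exp_def)
  then have "(flat_exp n has_real_derivative 0) (at t)"
    using DERIV_cong_ev[OF refl _ refl, of "\<lambda>x. 0" "flat_exp n" t 0] by auto
  then show ?thesis using less by (simp add: flat_exp_def)
next
  case equal
  \<comment> \<open>By \<open>flat_exp_mult\<close> the difference quotient at 0 is
    \<open>flat_exp (Suc n)\<close>, which tends to 0.\<close>
  have "((\<lambda>h. (flat_exp n (0 + h) - flat_exp n 0) / h) \<longlongrightarrow> 0) (at 0)"
    by (rule Lim_transform_eventually[OF flat_exp_tendsto_0[of "Suc n"]])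
      (auto simp: eventually_at_filter flat_exp_mult[of n])
  then have "(flat_exp n has_real_derivative 0) (at 0)"
    by (simp add: DERIV_def)
  then show ?thesis
    using equal by (simp add: flat_exp_def)
next
  case greater
  then have "eventually (\<lambda>x. x > 0) (nhds t)"
    using eventually_nhds_in_open[of "{0<..}" t] by simp
  then have ev: "eventually (\<lambda>x. inverse x ^ n * exp (- inverse x) = flat_exp n x) (nhds t)"
    by (rule eventually_mono) (auto simp: flat_exp_def)
  have "((\<lambda>x. inverse x ^ n * exp (- inverse x)) has_real_derivative
      (- real n * flat_exp (n + 1) t + flat_exp (n + 2) t)) (at t)"
  proof (cases n)
    case (Suc m)
    have "m \<noteq> 0 \<Longrightarrow> t * t ^ (m - Suc 0) = t ^ m"
      by (cases m) auto
    with greater Suc show ?thesis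
      by (fastforce intro!: derivative_eq_intros simp: flat_exp_def field_simps)
  qed (use greater in \<open>auto intro!: derivative_eq_intros simp: flat_exp_def field_simps\<close>)
  then show ?thesis
    using DERIV_cong_ev[OF refl ev refl] by blast
qed

lemma smooth_on_flat_exp: "smooth_on UNIV (flat_exp n)"
proof -
  have "higher_differentiable_on UNIV (flat_exp n) k" for k
  proof (induction k arbitrary: n)
    case 0
    show ?case
      using DERIV_flat_exp DERIV_isCont continuous_at_imp_continuous_on by (metis higher_differentiable_on.simps(1))
  next
    case (Suc k)
    show ?case
      by (rule higher_differentiable_on_SucI[OF open_UNIV
            DERIV_flat_exp[unfolded has_field_derivative_def]])
        (intro higher_differentiable_on_mult higher_differentiable_on_add
          higher_differentiable_on_const open_UNIV Suc)
  qed
  then show ?thesis by (simp add: smooth_on_def)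
qed

lemma smooth_bump_exists:
  fixes a :: "'a::euclidean_space"
  assumes "r > 0"
  obtains \<psi> :: "'a \<Rightarrow> real"
  where "smooth_on UNIV \<psi>" "\<psi> a \<noteq> 0" "\<And>x. x \<notin> cball a r \<Longrightarrow> \<psi> x = 0"
proof
  \<comment> \<open>A polynomial in the coordinates, hence smooth by the closure rules; its value is
    \<open>r\<^sup>2 - (dist a x)\<^sup>2\<close>, which is positive exactly inside the ball, where
    \<open>flat_exp 0\<close> does not vanish.\<close>
  define u where "u = (\<lambda>x::'a. r\<^sup>2 + -1 * (\<Sum>b\<in>Basis. (x \<bullet> b + - (a \<bullet> b)) * (x \<bullet> b + - (a \<bullet> b))))"
  have u: "u x = r\<^sup>2 - (dist a x)\<^sup>2" for x
  proof -
    have "(dist a x)\<^sup>2 = (x - a) \<bullet> (x - a)"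
      unfolding dist_commute[of a] dist_norm power2_norm_eq_inner
      by (simp add: inner_diff_left inner_diff_right)
    also have "\<dots> = (\<Sum>b\<in>Basis. ((x - a) \<bullet> b) * ((x - a) \<bullet> b))"
      by (rule euclidean_inner)
    finally show ?thesis
      by (simp add: u_def inner_diff_left)
  qed
  have "smooth_on UNIV u"
    unfolding u_def
    by (intro smooth_on_add smooth_on_mult smooth_on_sum smooth_on_const smooth_on_bounded_linear
        open_UNIV finite_Basis bounded_linear_inner_left)
  then show "smooth_on UNIV (\<lambda>x. flat_exp 0 (u x))"
    by (intro smooth_on_compose[OF open_UNIV open_UNIV _ _ smooth_on_flat_exp]) auto
  show "flat_exp 0 (u a) \<noteq> 0"
    using assms by (simp add: u flat_exp_def)
  show "flat_exp 0 (u x) = 0" if "x \<notin> cball a r" for x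
    using that assms power_strict_mono[of r "dist a x" 2] by (simp add: u flat_exp_def)
qed

section \<open>Smooth functions and vector fields on a manifold\<close>

locale smooth_manifold =
  fixes \<A> :: "('m::t2_space, 'e::euclidean_space) chart set"
  assumes atlas: "smooth_atlas \<A>"
begin

abbreviation "\<F> \<equiv> smooth_functions \<A>"
abbreviation "\<X> \<equiv> vector_fields \<A>"
abbreviation "\<T> \<equiv> tangent_space \<A>"

lemma chartD:
  assumes "(U, c) \<in> \<A>"
  shows "open U" "open (c ` U)" "homeomorphism U (c ` U) c (inv_into U c)"
proof -
  have "\<forall>(U, c)\<in>\<A>. open U \<and> open (c ` U) \<and> homeomorphism U (c ` U) c (inv_into U c)"
    using atlas unfolding smooth_atlas_def by (elim conjE)
  from bspec[OF this assms]
  show "open U" "open (c ` U)" "homeomorphism U (c ` U) c (inv_into U c)"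
    by simp_all
qed

lemma chart_exists: obtains U c where "(U, c) \<in> \<A>" "p \<in> U"
proof -
  have "p \<in> (\<Union>(U, c)\<in>\<A>. U)"
    using atlas unfolding smooth_atlas_def by simp
  then show ?thesis using that by auto
qed

lemma chart_inverse: "(U, c) \<in> \<A> \<Longrightarrow> p \<in> U \<Longrightarrow> inv_into U c (c p) = p"
  using chartD(3) by (auto simp: homeomorphism_def)

lemma open_chart_image:
  assumes "(U, c) \<in> \<A>" "open W" "W \<subseteq> U"
  shows "open (c ` W)"
proof -
  have "openin (top_of_set U) W"
    using assms by (auto simp: openin_open)
  then show ?thesis
    using homeomorphism_imp_open_map[OF chartD(3)[OF assms(1)]]
      openin_open_trans[OF _ chartD(2)[OF assms(1)]] by simp
qed

lemma chart_transition:
  assumes "(U, c) \<in> \<A>" "(V, d) \<in> \<A>"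
  shows "smooth_on (c ` (U \<inter> V)) (\<lambda>x. d (inv_into U c x))"
proof -
  have "\<forall>(U, c)\<in>\<A>. \<forall>(V, d)\<in>\<A>. smooth_on (c ` (U \<inter> V)) (d \<circ> inv_into U c)"
    using atlas unfolding smooth_atlas_def by (elim conjE)
  from bspec[OF this assms(1)] show ?thesis
    using assms(2) by (auto simp: comp_def)
qed

lemma smooth_functionsD:
  "f \<in> \<F> \<Longrightarrow> (U, c) \<in> \<A> \<Longrightarrow> smooth_on (c ` U) (\<lambda>x. f (inv_into U c x))"
  by (auto simp: smooth_functions_def comp_def)

lemma smooth_functionsI:
  "(\<And>U c. (U, c) \<in> \<A> \<Longrightarrow> smooth_on (c ` U) (\<lambda>x. f (inv_into U c x))) \<Longrightarrow> f \<in> \<F>"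
  by (auto simp: smooth_functions_def comp_def)

lemma smooth_const [intro, simp]: "(\<lambda>q. a) \<in> \<F>"
  by (rule smooth_functionsI) (rule smooth_on_const[OF chartD(2)])

lemma smooth_add [intro]: "f \<in> \<F> \<Longrightarrow> h \<in> \<F> \<Longrightarrow> (\<lambda>q. f q + h q) \<in> \<F>"
  by (rule smooth_functionsI)
    (rule smooth_on_add[OF chartD(2) smooth_functionsD[of f] smooth_functionsD[of h]])

lemma smooth_mult [intro]: "f \<in> \<F> \<Longrightarrow> h \<in> \<F> \<Longrightarrow> (\<lambda>q. f q * h q) \<in> \<F>"
  by (rule smooth_functionsI)
    (rule smooth_on_mult[OF chartD(2) smooth_functionsD[of f] smooth_functionsD[of h]])

lemma smooth_uminus [intro]: "f \<in> \<F> \<Longrightarrow> (\<lambda>q. - f q) \<in> \<F>"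
  using smooth_mult[OF smooth_const[of "-1"]] by simp

lemma smooth_diff [intro]: "f \<in> \<F> \<Longrightarrow> h \<in> \<F> \<Longrightarrow> (\<lambda>q. f q - h q) \<in> \<F>"
  using smooth_add[of f "\<lambda>q. - h q"] smooth_uminus[of h] by simp

text \<open>Smoothness is local, and near \<open>p\<close> the product can be divided by the
  nonvanishing \<sigma>. Needed for \<kappa> and \<tau>, which are reached only after multiplication
  by powers of \<open>g q (P q) (N q)\<close>.\<close>

lemma smooth_divide_local:
  assumes "\<And>p. \<exists>\<sigma>\<in>\<F>. \<sigma> p \<noteq> 0 \<and> (\<lambda>q. \<sigma> q * f q) \<in> \<F>"
  shows "f \<in> \<F>"
proof (intro smooth_functionsI smooth_on_local)
  fix U c x assume Uc: "(U, c) \<in> \<A>" and x: "x \<in> c ` U"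
  let ?c' = "inv_into U c"
  obtain \<sigma> where \<sigma>: "\<sigma> \<in> \<F>" "\<sigma> (?c' x) \<noteq> 0" "(\<lambda>q. \<sigma> q * f q) \<in> \<F>"
    using assms by blast
  have s: "smooth_on (c ` U) (\<lambda>y. \<sigma> (?c' y))"
    using smooth_functionsD[OF \<sigma>(1) Uc] .
  define N where "N = c ` U \<inter> (\<lambda>y. \<sigma> (?c' y)) -` (- {0})"
  have N: "open N"
    unfolding N_def using smooth_on_imp_continuous_on[OF s] chartD(2)[OF Uc]
    by (intro continuous_open_preimage) auto
  have "smooth_on N (\<lambda>y. inverse (\<sigma> (?c' y)) * (\<sigma> (?c' y) * f (?c' y)))"
    by (rule smooth_on_mult[OF N smooth_on_inverse[OF N smooth_on_mono[OF s]]
          smooth_on_mono[OF smooth_functionsD[OF \<sigma>(3) Uc]]]) (auto simp: N_def)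
  then have "smooth_on N (\<lambda>y. f (?c' y))"
    by (rule smooth_on_cong[OF N]) (auto simp: N_def)
  then show "\<exists>T. open T \<and> x \<in> T \<and> smooth_on T (\<lambda>y. f (?c' y))"
    using N x \<sigma>(2) by (auto simp: N_def intro!: exI[of _ N])
qed

text \<open>Turns functions of the coordinates into functions on the whole manifold. The preimage
  \<open>K\<close> of the ball carrying the cutoff is compact, hence closed in a Hausdorff space; so
  \<open>U\<close> and the complement of \<open>K\<close> are open and cover everything, and on the
  latter the extended function is 0.\<close>

lemma chart_cutoff:
  assumes "(U, c) \<in> \<A>" "p \<in> U"
  obtains \<psi> where "smooth_on UNIV \<psi>" "\<psi> (c p) \<noteq> 0"
    "\<And>G. smooth_on (c ` U) G \<Longrightarrow> (\<lambda>q. if q \<in> U then \<psi> (c q) * G (c q) else 0) \<in> \<F>"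
proof -
  let ?c' = "inv_into U c"
  obtain r where r: "r > 0" "cball (c p) r \<subseteq> c ` U"
    using chartD(2)[OF assms(1)] assms(2) open_contains_cball by blast
  obtain \<psi> :: "'e \<Rightarrow> real" where \<psi>: "smooth_on UNIV \<psi>" "\<psi> (c p) \<noteq> 0"
    "\<And>x. x \<notin> cball (c p) r \<Longrightarrow> \<psi> x = 0"
    using smooth_bump_exists[OF r(1)] by metis
  define K where "K = ?c' ` cball (c p) r"
  have "continuous_on (cball (c p) r) ?c'"
    using chartD(3)[OF assms(1)] r(2) continuous_on_subset by (auto simp: homeomorphism_def)
  then have K: "closed K"
    unfolding K_def by (intro compact_imp_closed compact_continuous_image compact_cball)
  have K0: "\<psi> (c q) = 0" if "q \<in> U" "q \<notin> K" for q
    using that \<psi>(3) chart_inverse[OF assms(1)] by (force simp: K_def)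
  have KU: "K \<subseteq> U"
    unfolding K_def using r(2) inv_into_into by (metis image_subsetI subsetD)
  show ?thesis
  proof (rule that[OF \<psi>(1,2)])
    fix G :: "'e \<Rightarrow> real" assume G: "smooth_on (c ` U) G"
    define H where "H = (\<lambda>q. if q \<in> U then \<psi> (c q) * G (c q) else 0)"
    have "smooth_on (d ` V) (\<lambda>y. H (inv_into V d y))" if V: "(V, d) \<in> \<A>" for V d
    proof (rule smooth_on_local)
      fix y assume y: "y \<in> d ` V"
      let ?d' = "inv_into V d"
      have d': "?d' z \<in> V" "d (?d' z) = z" if "z \<in> d ` V" for z
        using that by (auto simp: inv_into_into f_inv_into_f)
      show "\<exists>T. open T \<and> y \<in> T \<and> smooth_on T (\<lambda>y. H (?d' y))"
      proof (cases "?d' y \<in> U")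
        case True
        define W where "W = d ` (V \<inter> U)"
        have W: "open W"
          unfolding W_def using V chartD(1) assms(1) by (intro open_chart_image) auto
        have im: "?d' z \<in> U" if "z \<in> W" for z
          using that chart_inverse[OF V] by (auto simp: W_def)
        have "smooth_on W (\<lambda>z. \<psi> (c (?d' z)) * G (c (?d' z)))"
          using chart_transition[OF V assms(1)] chartD(2)[OF assms(1)] G \<psi>(1) W im
          unfolding W_def[symmetric]
          by (intro smooth_on_mult smooth_on_compose[of _ "c ` U" "\<lambda>z. c (?d' z)"]
              smooth_on_mono[OF \<psi>(1)]) auto
        then have "smooth_on W (\<lambda>z. H (?d' z))"
          by (rule smooth_on_cong[OF W]) (auto simp: H_def im)
        moreover have "y \<in> W"
          using True d'[OF y] by (force simp: W_def)
        ultimately show ?thesis using W by blast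
      next
        case False
        define W where "W = d ` (V - K)"
        have W: "open W"
          unfolding W_def using V chartD(1) K by (intro open_chart_image) auto
        have "smooth_on W (\<lambda>z. H (?d' z))"
          by (rule smooth_on_cong[OF W smooth_on_const[OF W, of 0]])
            (use K0 chart_inverse[OF V] in \<open>auto simp: H_def W_def\<close>)
        moreover have "y \<in> W"
          using False KU d'[OF y] by (force simp: W_def)
        ultimately show ?thesis using W by blast
      qed
    qed
    then have "H \<in> \<F>"
      by (rule smooth_functionsI)
    then show "(\<lambda>q. if q \<in> U then \<psi> (c q) * G (c q) else 0) \<in> \<F>"
      by (simp add: H_def)
  qed
qed

section \<open>Tangent vectors and global vector fields\<close>

lemma tangentI:
  assumes "\<And>f h. f \<in> \<F> \<Longrightarrow> h \<in> \<F> \<Longrightarrow> v (\<lambda>q. f q + h q) = v f + v h"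
    and "\<And>f h. f \<in> \<F> \<Longrightarrow> h \<in> \<F> \<Longrightarrow> v (\<lambda>q. f q * h q) = f p * v h + h p * v f"
    and "\<And>f a. f \<in> \<F> \<Longrightarrow> v (\<lambda>q. a * f q) = a * v f"
    and "\<And>f. f \<notin> \<F> \<Longrightarrow> v f = 0"
  shows "v \<in> \<T> p"
  using assms by (auto simp: tangent_space_def)

lemma tangentD:
  assumes "v \<in> \<T> p"
  shows "f \<in> \<F> \<Longrightarrow> h \<in> \<F> \<Longrightarrow> v (\<lambda>q. f q + h q) = v f + v h"
    and "f \<in> \<F> \<Longrightarrow> h \<in> \<F> \<Longrightarrow> v (\<lambda>q. f q * h q) = f p * v h + h p * v f"
    and "f \<in> \<F> \<Longrightarrow> v (\<lambda>q. a * f q) = a * v f"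
    and "f \<notin> \<F> \<Longrightarrow> v f = 0"
  using assms by (auto simp: tangent_space_def)

lemma tangent_const: "v \<in> \<T> p \<Longrightarrow> v (\<lambda>q. a) = 0"
  using tangentD(2)[of v p "\<lambda>q. 1" "\<lambda>q. 1"] tangentD(3)[of v p "\<lambda>q. 1" a] by simp

lemma tangent_uminus: "v \<in> \<T> p \<Longrightarrow> f \<in> \<F> \<Longrightarrow> v (\<lambda>q. - f q) = - v f"
  using tangentD(3)[of v p f "-1"] by simp

lemma tangent_diff:
  "v \<in> \<T> p \<Longrightarrow> f \<in> \<F> \<Longrightarrow> h \<in> \<F> \<Longrightarrow> v (\<lambda>q. f q - h q) = v f - v h"
  using tangentD(1)[of v p f "\<lambda>q. - h q"] tangent_uminus[of v p h] by auto

lemma subspace_tangent_space: "subspace (\<T> p)"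
  by (rule subspaceI)
    (auto intro!: tangentI simp: tangentD scaleR_fun_def algebra_simps)

lemmas tangent_zero [simp] = subspace_0[OF subspace_tangent_space]
  and tangent_add [intro, simp] = subspace_add[OF subspace_tangent_space]
  and tangent_sub [intro, simp] = subspace_diff[OF subspace_tangent_space]
  and tangent_neg [intro, simp] = subspace_neg[OF subspace_tangent_space]
  and tangent_scale [intro, simp] = subspace_scale[OF subspace_tangent_space]

lemma vector_fieldsI:
  "(\<And>p. X p \<in> \<T> p) \<Longrightarrow> (\<And>f. f \<in> \<F> \<Longrightarrow> (\<lambda>p. X p f) \<in> \<F>) \<Longrightarrow> X \<in> \<X>"
  by (simp add: vector_fields_def)

lemma field_tangent: "X \<in> \<X> \<Longrightarrow> X p \<in> \<T> p"
  by (simp add: vector_fields_def)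

lemma field_smooth: "X \<in> \<X> \<Longrightarrow> f \<in> \<F> \<Longrightarrow> (\<lambda>p. X p f) \<in> \<F>"
  by (simp add: vector_fields_def)

lemma field_not_smooth: "X \<in> \<X> \<Longrightarrow> f \<notin> \<F> \<Longrightarrow> X p f = 0"
  using field_tangent tangentD(4) by blast

lemma field_zero [simp]: "0 \<in> \<X>"
  by (rule vector_fieldsI) (simp_all only: zero_fun_apply tangent_zero smooth_const)

lemma field_add [simp]:
  assumes "X \<in> \<X>" "Y \<in> \<X>"
  shows "X + Y \<in> \<X>"
  by (rule vector_fieldsI)
    (simp_all only: plus_fun_apply tangent_add smooth_add assms[THEN field_tangent] assms[THEN field_smooth])

lemma field_diff [simp]:
  assumes "X \<in> \<X>" "Y \<in> \<X>"
  shows "X - Y \<in> \<X>"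
  by (rule vector_fieldsI)
    (simp_all only: minus_apply tangent_sub smooth_diff assms[THEN field_tangent] assms[THEN field_smooth])

lemma field_scale [simp]:
  assumes "f \<in> \<F>" "X \<in> \<X>"
  shows "(\<lambda>p. f p *\<^sub>R X p) \<in> \<X>"
proof (rule vector_fieldsI)
  show "f p *\<^sub>R X p \<in> \<T> p" for p
    by (rule tangent_scale[OF field_tangent[OF assms(2)]])
  show "(\<lambda>p. (f p *\<^sub>R X p) h) \<in> \<F>" if "h \<in> \<F>" for h
    unfolding scaleR_fun_def real_scaleR_def
    by (rule smooth_mult[OF assms(1) field_smooth[OF assms(2) that]])
qed

lemma field_bracket [simp]:
  assumes "X \<in> \<X>" "Y \<in> \<X>"
  shows "lie_bracket X Y \<in> \<X>"
proof (rule vector_fieldsI)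
  fix p
  note X = tangentD[OF field_tangent[OF assms(1)]] and Y = tangentD[OF field_tangent[OF assms(2)]]
  note s = field_smooth[OF assms(1)] field_smooth[OF assms(2)]
  show "lie_bracket X Y p \<in> \<T> p"
  proof (rule tangentI)
    show "lie_bracket X Y p (\<lambda>q. f q + h q) = lie_bracket X Y p f + lie_bracket X Y p h"
      if "f \<in> \<F>" "h \<in> \<F>" for f h
      using that by (simp add: lie_bracket_def X(1) Y(1) s)
    show "lie_bracket X Y p (\<lambda>q. f q * h q) = f p * lie_bracket X Y p h + h p * lie_bracket X Y p f"
      if "f \<in> \<F>" "h \<in> \<F>" for f h
      using that 
      by (simp add: lie_bracket_def X(1,2) Y(1,2) s smooth_mult algebra_simps)
    show "lie_bracket X Y p (\<lambda>q. a * f q) = a * lie_bracket X Y p f" if "f \<in> \<F>" for f a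
      using that by (simp add: lie_bracket_def X(3) Y(3) s algebra_simps)
    \<comment> \<open>Off the smooth functions both inner derivatives are 0 at every point, so each
      outer vector is applied to a constant function.\<close>
    show "lie_bracket X Y p f = 0" if "f \<notin> \<F>" for f
      using that by (simp add: lie_bracket_def X(4) Y(4) tangent_const[OF field_tangent] assms)
  qed
next
  show "(\<lambda>p. lie_bracket X Y p f) \<in> \<F>" if "f \<in> \<F>" for f
    unfolding lie_bracket_def
    using smooth_diff[OF field_smooth[OF assms(1) field_smooth[OF assms(2) that]]
        field_smooth[OF assms(2) field_smooth[OF assms(1) that]]] .
qed

section \<open>Coordinate fields, extension of tangent vectors, locally constant functions\<close>

lemma chart_function_has_derivative:
  assumes "(U, c) \<in> \<A>" "f \<in> \<F>" "q \<in> U"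
  shows "((\<lambda>x. f (inv_into U c x)) has_derivative
    frechet_derivative (\<lambda>x. f (inv_into U c x)) (at (c q))) (at (c q))"
  using smooth_on_imp_has_derivative[OF smooth_functionsD[OF assms(2,1)]] assms(3) by blast

text \<open>Directional derivatives in a chart, multiplied by a cutoff so that they become global
  fields. The factor \<open>w\<close> is the value of the cutoff at \<open>p\<close>; only that it
  is nonzero matters.\<close>

lemma coordinate_fields:
  assumes "(U, c) \<in> \<A>" "p \<in> U"
  obtains E w where "w \<noteq> 0" "\<And>v. E v \<in> \<X>"
    "\<And>v f. f \<in> \<F> \<Longrightarrow> E v p f = w * frechet_derivative (\<lambda>x. f (inv_into U c x)) (at (c p)) v"
proof -
  obtain \<psi> where \<psi>: "smooth_on UNIV \<psi>" "\<psi> (c p) \<noteq> 0"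
    "\<And>G. smooth_on (c ` U) G \<Longrightarrow> (\<lambda>q. if q \<in> U then \<psi> (c q) * G (c q) else 0) \<in> \<F>"
    using chart_cutoff[OF assms] by metis
  define pd where "pd f q = frechet_derivative (\<lambda>x. f (inv_into U c x)) (at (c q))" for f :: "'m \<Rightarrow> real" and q
  \<comment> \<open>The test for smoothness of \<open>f\<close> provides the normalisation that
    \<open>tangent_space\<close> demands of its functionals.\<close>
  define E where "E v q f = (if f \<in> \<F> then if q \<in> U then \<psi> (c q) * pd f q v else 0 else 0)" for v q f
  have pd: "((\<lambda>x. f (inv_into U c x)) has_derivative pd f q) (at (c q))" if "f \<in> \<F>" "q \<in> U" for f q
    using chart_function_has_derivative[OF assms(1) that] by (simp add: pd_def)
  have add: "pd (\<lambda>q. f q + h q) q v = pd f q v + pd h q v"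
    if "f \<in> \<F>" "h \<in> \<F>" "q \<in> U" for f h q v
    unfolding pd_def[of "\<lambda>q. f q + h q"]
    by (subst frechet_derivative_at[OF has_derivative_add[OF pd[OF that(1,3)] pd[OF that(2,3)]], symmetric])
      (rule refl)
  have mult: "pd (\<lambda>q. f q * h q) q v = f q * pd h q v + h q * pd f q v"
    if "f \<in> \<F>" "h \<in> \<F>" "q \<in> U" for f h q v
    unfolding pd_def[of "\<lambda>q. f q * h q"]
    by (subst frechet_derivative_at[OF has_derivative_mult[OF pd[OF that(1,3)] pd[OF that(2,3)]], symmetric])
      (simp add: chart_inverse[OF assms(1) that(3)])
  have scale: "pd (\<lambda>q. a * f q) q v = a * pd f q v"
    if "f \<in> \<F>" "q \<in> U" for f a q v
    unfolding pd_def[of "\<lambda>q. a * f q"]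
    by (subst frechet_derivative_at[OF has_derivative_mult_right[OF pd[OF that]], symmetric]) simp
  have E: "E v \<in> \<X>" for v
  proof (rule vector_fieldsI)
    show "E v q \<in> \<T> q" for q
    proof (rule tangentI)
      show "E v q (\<lambda>q. a * f q) = a * E v q f" if "f \<in> \<F>" for f a
        using that smooth_mult[OF smooth_const that] by (simp add: E_def scale)
    qed (auto simp: E_def add mult algebra_simps)
    show "(\<lambda>q. E v q f) \<in> \<F>" if "f \<in> \<F>" for f
      using \<psi>(3)[OF smooth_on_frechet_derivative[OF smooth_functionsD[OF that assms(1)], of v]]
      unfolding E_def pd_def if_P[OF that] .
  qed
  show ?thesis
    by (rule that[of "\<psi> (c p)" E]) (use \<psi>(2) E assms(2) in \<open>auto simp: E_def pd_def\<close>)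
qed

text \<open>A dimension count: the cutoff coordinate fields give \<open>DIM('e)\<close> independent
  vectors at \<open>p\<close>, and a spanning set of at most that size leaves no room for a further
  one. So \<open>x\<close> itself is the value of some \<open>E v\<close>, and no combination of
  fields has to be formed afterwards.\<close>

lemma extension_exists_if_spanned:
  assumes "finite S" "card S \<le> DIM('e)" "\<T> p \<subseteq> span S" "x \<in> \<T> p"
  shows "\<exists>X\<in>\<X>. X p = x"
proof -
  obtain U c where Uc: "(U, c) \<in> \<A>" "p \<in> U"
    using chart_exists .
  obtain E w where E: "w \<noteq> 0" "\<And>v. E v \<in> \<X>"
    "\<And>v f. f \<in> \<F> \<Longrightarrow> E v p f = w * frechet_derivative (\<lambda>x. f (inv_into U c x)) (at (c p)) v"
    using coordinate_fields[OF Uc] by metis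
  obtain \<psi> where \<psi>: "smooth_on UNIV \<psi>" "\<psi> (c p) \<noteq> 0"
    "\<And>G. smooth_on (c ` U) G \<Longrightarrow> (\<lambda>q. if q \<in> U then \<psi> (c q) * G (c q) else 0) \<in> \<F>"
    using chart_cutoff[OF Uc] by metis
  \<comment> \<open>Cutoff coordinate functions, centred at \<open>p\<close>: the derivative of the
    cutoff is multiplied by 0 there, so up to a nonzero factor they are dual to the vectors
    \<open>E v p\<close> and prove these independent.\<close>
  define u where "u b q = (if q \<in> U then \<psi> (c q) * (c q \<bullet> b + - (c p \<bullet> b)) else 0)" for b q
  have u: "u b \<in> \<F>" for b
    unfolding u_def using chartD(2)[OF Uc(1)]
    by (intro \<psi>(3)[of "\<lambda>y. y \<bullet> b + - (c p \<bullet> b)"] smooth_on_add smooth_on_const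
        smooth_on_bounded_linear bounded_linear_inner_left)
  have Eu: "E v p (u b) = w * \<psi> (c p) * (v \<bullet> b)" for v b
  proof -
    have *: "((\<lambda>y. \<psi> y * (y \<bullet> b - c p \<bullet> b)) has_derivative (\<lambda>v. \<psi> (c p) * (v \<bullet> b))) (at (c p))"
      by (auto intro!: derivative_eq_intros smooth_on_imp_has_derivative[OF \<psi>(1)])
    have "((\<lambda>y. u b (inv_into U c y)) has_derivative (\<lambda>v. \<psi> (c p) * (v \<bullet> b))) (at (c p))"
      by (rule has_derivative_transform_within_open[OF * chartD(2)[OF Uc(1)]])
        (use Uc chart_inverse[OF Uc(1)] in \<open>auto simp: u_def\<close>)
    from frechet_derivative_at[OF this] show ?thesis
      using E(3)[OF u, of v b] by (simp add: fun_eq_iff)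
  qed
  let ?E = "\<lambda>v. E v p"
  have lin: "linear ?E"
  proof (rule linearI)
    note d = linear_frechet_derivative[OF differentiableI[OF
          chart_function_has_derivative[OF Uc(1) _ Uc(2)]]]
    show "E (v + v') p = E v p + E v' p" for v v'
    proof
      show "E (v + v') p f = (E v p + E v' p) f" for f
        using linear_add[OF d] by (cases "f \<in> \<F>") (simp_all add: E field_not_smooth algebra_simps)
    qed
    show "E (a *\<^sub>R v) p = a *\<^sub>R E v p" for a v
    proof
      show "E (a *\<^sub>R v) p f = (a *\<^sub>R E v p) f" for f
        using linear_cmul[OF d]
        by (cases "f \<in> \<F>") (simp_all add: E field_not_smooth scaleR_fun_def)
    qed
  qed
  have inj: "inj ?E"
  proof (subst linear_injective_0[OF lin], intro allI impI)
    fix v assume "E v p = 0"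
    then have "E v p (u v) = 0"
      by (simp only: zero_fun_apply)
    then show "v = 0"
      using E(1) \<psi>(2) unfolding Eu by simp
  qed
  have ind: "independent (?E ` Basis)"
    by (rule linear_independent_injective_image[OF lin independent_Basis inj_on_subset[OF inj subset_UNIV]])
  have sub: "?E ` Basis \<subseteq> \<T> p"
    using field_tangent[OF E(2)] by (intro image_subsetI)
  have "x \<in> span (?E ` Basis)"
  proof (rule ccontr)
    assume x: "x \<notin> span (?E ` Basis)"
    then have "independent (insert x (?E ` Basis))"
      using ind by (rule independent_insertI)
    moreover have "insert x (?E ` Basis) \<subseteq> span S"
      using assms(3,4) sub by auto
    ultimately have "card (insert x (?E ` Basis)) \<le> card S"
      using independent_span_bound[OF assms(1)] by auto
    moreover have "x \<notin> ?E ` Basis"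
      using x span_base[of x "?E ` Basis"] by argo
    moreover have "card (?E ` Basis) = DIM('e)"
      by (rule card_image[OF inj_on_subset[OF inj subset_UNIV]])
    ultimately show False
      using assms(2) by simp
  qed
  then have "x \<in> range ?E"
    by (simp add: linear_span_image[OF lin])
  then show ?thesis
    using E(2) by auto
qed

text \<open>Coordinate fields turn the hypothesis on derivations into a vanishing derivative in each
  chart. On the preimage of a ball, which is convex, the function is then constant, and
  connectedness does the rest.\<close>

lemma constant_if_derivatives_zero:
  assumes "f \<in> \<F>" "\<And>p x. x \<in> \<T> p \<Longrightarrow> x f = 0" "connected (UNIV :: 'm set)"
  shows "f constant_on UNIV"
proof -
  have ev: "eventually (\<lambda>q. f p = f q) (nhds p)" for p
  proof -
    obtain U c where Uc: "(U, c) \<in> \<A>" "p \<in> U"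
      using chart_exists .
    let ?f = "\<lambda>x. f (inv_into U c x)"
    obtain r where r: "r > 0" "ball (c p) r \<subseteq> c ` U"
      using chartD(2)[OF Uc(1)] Uc(2) open_contains_ball by blast
    have D0: "frechet_derivative ?f (at (c q)) = (\<lambda>v. 0)" if q: "q \<in> U" for q
    proof
      fix v
      obtain E w where E: "w \<noteq> 0" "\<And>v. E v \<in> \<X>"
        "\<And>v f. f \<in> \<F> \<Longrightarrow> E v q f = w * frechet_derivative (\<lambda>x. f (inv_into U c x)) (at (c q)) v"
        using coordinate_fields[OF Uc(1) q] by metis
      show "frechet_derivative ?f (at (c q)) v = 0"
        using assms(2)[OF field_tangent[OF E(2)], of v q] E(1) unfolding E(3)[OF assms(1)] by simp
    qed
    have der: "(?f has_derivative (\<lambda>v. 0)) (at x within ball (c p) r)" if x: "x \<in> ball (c p) r" for x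
    proof -
      obtain q where q: "q \<in> U" "x = c q" using r(2) x by blast
      then show ?thesis
        using chart_function_has_derivative[OF Uc(1) assms(1) q(1)] D0[OF q(1)]
        by (auto intro: has_derivative_at_withinI)
    qed
    obtain k where k: "\<And>x. x \<in> ball (c p) r \<Longrightarrow> ?f x = k"
      using has_derivative_zero_constant[OF convex_ball der] by metis
    have k': "f q = k" if "q \<in> U" "c q \<in> ball (c p) r" for q
      using k[OF that(2)] chart_inverse[OF Uc(1) that(1)] by simp
    have "open (U \<inter> c -` ball (c p) r)"
      using chartD[OF Uc(1)] by (intro continuous_open_preimage) (auto simp: homeomorphism_def)
    then have "eventually (\<lambda>q. q \<in> U \<inter> c -` ball (c p) r) (nhds p)"
      using Uc(2) r(1) by (intro eventually_nhds_in_open) auto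
    then show ?thesis
      by (rule eventually_mono) (use k' Uc(2) r(1) in auto)
  qed
  have "f p = f q" for p q
    by (rule connected_local_const[OF assms(3)])
      (auto simp: eventually_at_filter intro: eventually_mono[OF ev])
  then show ?thesis
    unfolding constant_on_def by metis
qed

end

section \<open>Curvature of the Levi-Civita connection\<close>

context smooth_manifold
begin

declare field_tangent [simp] field_smooth [simp]

lemma bracket_antisym: "lie_bracket Y X = - lie_bracket X Y"
  by (simp add: lie_bracket_def fun_eq_iff)

lemma bracket_jacobi:
  assumes "X \<in> \<X>" "Y \<in> \<X>" "Z \<in> \<X>"
  shows "lie_bracket X (lie_bracket Y Z) + lie_bracket Y (lie_bracket Z X)
    + lie_bracket Z (lie_bracket X Y) = 0"
proof (intro ext)
  fix p f
  note d = tangent_diff[OF field_tangent[OF assms(1)]] tangent_diff[OF field_tangent[OF assms(2)]]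
    tangent_diff[OF field_tangent[OF assms(3)]]
  show "(lie_bracket X (lie_bracket Y Z) + lie_bracket Y (lie_bracket Z X)
      + lie_bracket Z (lie_bracket X Y)) p f = 0 p f"
  proof (cases "f \<in> \<F>")
    case True
    then have s: "(\<lambda>q. V q (\<lambda>q. W q f)) \<in> \<F>" if "V \<in> \<X>" "W \<in> \<X>" for V W
      using that by simp
    show ?thesis
      using s assms by (simp add: lie_bracket_def d)
  next
    case False
    then show ?thesis
      using assms by (simp add: field_not_smooth)
  qed
qed

end

locale pseudo_riemannian = smooth_manifold \<A>
  for \<A> :: "('m::t2_space, 'e::euclidean_space) chart set" +
  fixes g :: "'m \<Rightarrow> 'm tvec \<Rightarrow> 'm tvec \<Rightarrow> real"
    and D :: "'m vfield \<Rightarrow> 'm vfield \<Rightarrow> 'm vfield"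
  assumes metric: "pseudo_riemannian_metric \<A> g"
    and levi_civita: "levi_civita_connection \<A> g D"
begin

lemma
  assumes "x \<in> \<T> p" "y \<in> \<T> p"
  shows g_sym: "g p x y = g p y x"
    and g_add1: "z \<in> \<T> p \<Longrightarrow> g p (x + z) y = g p x y + g p z y"
    and g_scale1: "g p (a *\<^sub>R x) y = a * g p x y"
proof -
  have *: "\<forall>x\<in>\<T> p. \<forall>y\<in>\<T> p. g p x y = g p y x \<and>
      (\<forall>z\<in>\<T> p. g p (x + z) y = g p x y + g p z y) \<and> (\<forall>a. g p (a *\<^sub>R x) y = a * g p x y)"
    using metric unfolding pseudo_riemannian_metric_def by (elim conjE allE)
  note bspec[OF bspec[OF * assms(1)] assms(2)]
  then show "g p x y = g p y x" "z \<in> \<T> p \<Longrightarrow> g p (x + z) y = g p x y + g p z y"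
    "g p (a *\<^sub>R x) y = a * g p x y"
    by simp_all
qed

lemma g_nondegenerate: "x \<in> \<T> p \<Longrightarrow> (\<And>y. y \<in> \<T> p \<Longrightarrow> g p x y = 0) \<Longrightarrow> x = 0"
  using metric by (auto simp: pseudo_riemannian_metric_def)

lemma g_smooth [simp]: "X \<in> \<X> \<Longrightarrow> Y \<in> \<X> \<Longrightarrow> (\<lambda>q. g q (X q) (Y q)) \<in> \<F>"
  using metric by (auto simp: pseudo_riemannian_metric_def)

lemma
  assumes "x \<in> \<T> p" "y \<in> \<T> p"
  shows g_add2: "z \<in> \<T> p \<Longrightarrow> g p y (x + z) = g p y x + g p y z"
    and g_scale2: "g p y (a *\<^sub>R x) = a * g p y x"
  using g_sym[of "x + z" p y] g_sym[of x p y] g_sym[of z p y] g_sym[of "a *\<^sub>R x" p y]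
    g_add1 g_scale1 assms by simp_all

lemma g_zero1: "y \<in> \<T> p \<Longrightarrow> g p 0 y = 0"
  using g_scale1[of 0 p y 0] by simp

lemma g_zero2: "y \<in> \<T> p \<Longrightarrow> g p y 0 = 0"
  using g_scale2[of 0 p y 0] by simp

lemma g_neg1: "x \<in> \<T> p \<Longrightarrow> y \<in> \<T> p \<Longrightarrow> g p (- x) y = - g p x y"
  using g_scale1[of x p y "-1"] by simp

lemma g_neg2: "x \<in> \<T> p \<Longrightarrow> y \<in> \<T> p \<Longrightarrow> g p x (- y) = - g p x y"
  using g_scale2[of y p x "-1"] by simp

lemma g_diff1: "x \<in> \<T> p \<Longrightarrow> y \<in> \<T> p \<Longrightarrow> z \<in> \<T> p \<Longrightarrow> g p (x - z) y = g p x y - g p z y"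
  using g_add1[of x p y "- z"] by (simp add: g_neg1)

lemma g_diff2: "x \<in> \<T> p \<Longrightarrow> y \<in> \<T> p \<Longrightarrow> z \<in> \<T> p \<Longrightarrow> g p y (x - z) = g p y x - g p y z"
  using g_add2[of x p y "- z"] by (simp add: g_neg2)

lemmas g_linear = g_add1 g_add2 g_scale1 g_scale2 g_neg1 g_neg2 g_diff1 g_diff2 g_zero1 g_zero2

lemma g_unique:
  assumes "x \<in> \<T> p" "y \<in> \<T> p" "\<And>z. z \<in> \<T> p \<Longrightarrow> g p x z = g p y z"
  shows "x = y"
  using g_nondegenerate[of "x - y" p] assms by (simp add: g_diff1)

lemma connection: "affine_connection \<A> D"
  using levi_civita by (simp add: levi_civita_connection_def)

lemma D_closed [simp]: "X \<in> \<X> \<Longrightarrow> Y \<in> \<X> \<Longrightarrow> D X Y \<in> \<X>"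
  using connection by (auto simp: affine_connection_def)

lemma D_add1: "X \<in> \<X> \<Longrightarrow> Y \<in> \<X> \<Longrightarrow> Z \<in> \<X> \<Longrightarrow> D (X + Z) Y = D X Y + D Z Y"
  using connection by (auto simp: affine_connection_def)

lemma D_add2: "X \<in> \<X> \<Longrightarrow> Y \<in> \<X> \<Longrightarrow> Z \<in> \<X> \<Longrightarrow> D X (Y + Z) = D X Y + D X Z"
  using connection by (auto simp: affine_connection_def)

lemma D_scale1:
  "X \<in> \<X> \<Longrightarrow> Y \<in> \<X> \<Longrightarrow> f \<in> \<F> \<Longrightarrow> D (\<lambda>p. f p *\<^sub>R X p) Y = (\<lambda>p. f p *\<^sub>R D X Y p)"
  using connection by (auto simp: affine_connection_def)

lemma D_scale2:
  "X \<in> \<X> \<Longrightarrow> Y \<in> \<X> \<Longrightarrow> f \<in> \<F> \<Longrightarrow>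
    D X (\<lambda>p. f p *\<^sub>R Y p) = (\<lambda>p. X p f *\<^sub>R Y p + f p *\<^sub>R D X Y p)"
  using connection by (auto simp: affine_connection_def)

lemma D_diff1:
  assumes "X \<in> \<X>" "Y \<in> \<X>" "Z \<in> \<X>"
  shows "D (X - Z) Y = D X Y - D Z Y"
  using D_add1[of "X - Z" Y Z] assms by (simp add: algebra_simps)

lemma D_diff2:
  assumes "X \<in> \<X>" "Y \<in> \<X>" "Z \<in> \<X>"
  shows "D X (Y - Z) = D X Y - D X Z"
  using D_add2[of X "Y - Z" Z] assms by (simp add: algebra_simps)

lemma D_zero1: "Y \<in> \<X> \<Longrightarrow> D 0 Y = 0"
  using D_diff1[of 0 Y 0] by simp

lemma D_zero2: "X \<in> \<X> \<Longrightarrow> D X 0 = 0"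
  using D_diff2[of X 0 0] by simp

lemma bracket_eq: "X \<in> \<X> \<Longrightarrow> Y \<in> \<X> \<Longrightarrow> lie_bracket X Y = D X Y - D Y X"
  using levi_civita by (auto simp: levi_civita_connection_def)

lemma metric_compatible:
  "X \<in> \<X> \<Longrightarrow> Y \<in> \<X> \<Longrightarrow> Z \<in> \<X> \<Longrightarrow>
    X p (\<lambda>q. g q (Y q) (Z q)) = g p (D X Y p) (Z p) + g p (Y p) (D X Z p)"
  using levi_civita by (auto simp: levi_civita_connection_def)

section \<open>Symmetries of the curvature and the two Bianchi identities\<close>

abbreviation "R \<equiv> curvature D"

lemma curvature_closed [simp]: "X \<in> \<X> \<Longrightarrow> Y \<in> \<X> \<Longrightarrow> Z \<in> \<X> \<Longrightarrow> R X Y Z \<in> \<X>"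
  by (simp add: curvature_def)

lemma curvature_antisym:
  assumes "X \<in> \<X>" "Y \<in> \<X>" "Z \<in> \<X>"
  shows "R Y X Z = - R X Y Z"
  using assms by (simp add: curvature_def bracket_eq D_diff1 algebra_simps)

lemma curvature_add1:
  assumes "X \<in> \<X>" "X' \<in> \<X>" "Y \<in> \<X>" "Z \<in> \<X>"
  shows "R (X + X') Y Z = R X Y Z + R X' Y Z"
  using assms by (simp add: curvature_def bracket_eq D_diff1 D_diff2 D_add1 D_add2 algebra_simps)

lemma curvature_add3:
  assumes "X \<in> \<X>" "Z' \<in> \<X>" "Y \<in> \<X>" "Z \<in> \<X>"
  shows "R X Y (Z + Z') = R X Y Z + R X Y Z'"
  using assms by (simp add: curvature_def bracket_eq D_diff1 D_diff2 D_add1 D_add2 algebra_simps)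

text \<open>The derivative of \<open>f\<close> from \<open>D Y\<close> applied to \<open>f\<close>
  times \<open>D X Z\<close> cancels against the one that \<open>f\<close> leaves in the bracket.
  The second slot follows later by antisymmetry.\<close>

lemma curvature_scale1:
  assumes "X \<in> \<X>" "Y \<in> \<X>" "Z \<in> \<X>" "f \<in> \<F>"
  shows "R (\<lambda>q. f q *\<^sub>R X q) Y Z p = f p *\<^sub>R R X Y Z p"
proof -
  have b: "lie_bracket (\<lambda>q. f q *\<^sub>R X q) Y = (\<lambda>q. f q *\<^sub>R lie_bracket X Y q) - (\<lambda>q. Y q f *\<^sub>R X q)"
    using assms by (auto simp: bracket_eq D_scale1 D_scale2 algebra_simps)
  have eq: "R (\<lambda>q. f q *\<^sub>R X q) Y Z = (\<lambda>q. f q *\<^sub>R D X (D Y Z) q)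
      - (\<lambda>q. Y q f *\<^sub>R D X Z q + f q *\<^sub>R D Y (D X Z) q)
      - ((\<lambda>q. f q *\<^sub>R D (lie_bracket X Y) Z q) - (\<lambda>q. Y q f *\<^sub>R D X Z q))"
    unfolding curvature_def b using assms by (simp add: D_scale1 D_scale2 D_diff1)
  show ?thesis
    unfolding eq by (simp add: curvature_def algebra_simps)
qed

text \<open>First derivatives of \<open>f\<close> cancel in pairs, and the commutator of its second
  derivatives is removed by the bracket term.\<close>

lemma curvature_scale3:
  assumes "X \<in> \<X>" "Y \<in> \<X>" "Z \<in> \<X>" "f \<in> \<F>"
  shows "R X Y (\<lambda>q. f q *\<^sub>R Z q) p = f p *\<^sub>R R X Y Z p"
proof -
  have DD: "D V (D W (\<lambda>q. f q *\<^sub>R Z q)) = (\<lambda>q. V q (\<lambda>q. W q f) *\<^sub>R Z q + W q f *\<^sub>R D V Z q)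
      + (\<lambda>q. V q f *\<^sub>R D W Z q + f q *\<^sub>R D V (D W Z) q)" if "V \<in> \<X>" "W \<in> \<X>" for V W
  proof -
    have "D W (\<lambda>q. f q *\<^sub>R Z q) = (\<lambda>q. W q f *\<^sub>R Z q) + (\<lambda>q. f q *\<^sub>R D W Z q)"
      using that assms by (auto simp: D_scale2)
    then show ?thesis
      using that assms by (simp add: D_add2 D_scale2)
  qed
  have "D (lie_bracket X Y) (\<lambda>q. f q *\<^sub>R Z q)
      = (\<lambda>q. lie_bracket X Y q f *\<^sub>R Z q + f q *\<^sub>R D (lie_bracket X Y) Z q)"
    using assms by (simp add: D_scale2)
  moreover have "X p (\<lambda>q. Y q f) = lie_bracket X Y p f + Y p (\<lambda>q. X q f)"
    by (simp add: lie_bracket_def)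
  ultimately show ?thesis
    using assms by (simp add: curvature_def DD algebra_simps)
qed

text \<open>Differentiate \<open>g q (Z q) (W q)\<close> along \<open>X\<close> and \<open>Y\<close>
  in both orders. The terms with one derivative on each factor are symmetric and cancel; the
  commutator is the derivative along the bracket.\<close>

lemma curvature_skew:
  assumes "X \<in> \<X>" "Y \<in> \<X>" "Z \<in> \<X>" "W \<in> \<X>"
  shows "g p (R X Y Z p) (W p) = - g p (R X Y W p) (Z p)"
proof -
  have XY: "V p (\<lambda>q. V' q (\<lambda>q. g q (Z q) (W q))) =
      g p (D V (D V' Z) p) (W p) + g p (D V' Z p) (D V W p)
      + (g p (D V Z p) (D V' W p) + g p (Z p) (D V (D V' W) p))" if "V \<in> \<X>" "V' \<in> \<X>" for V V'
  proof -
    have "(\<lambda>q. V' q (\<lambda>q. g q (Z q) (W q))) =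
        (\<lambda>q. g q (D V' Z q) (W q) + g q (Z q) (D V' W q))"
      using that assms by (simp add: metric_compatible)
    then show ?thesis
      using that assms tangentD(1)[OF field_tangent[OF that(1)]]
      by (simp add: metric_compatible)
  qed
  have "lie_bracket X Y p (\<lambda>q. g q (Z q) (W q)) =
      g p (D (lie_bracket X Y) Z p) (W p) + g p (Z p) (D (lie_bracket X Y) W p)"
    using assms by (simp add: metric_compatible)
  moreover have "lie_bracket X Y p (\<lambda>q. g q (Z q) (W q)) =
      X p (\<lambda>q. Y q (\<lambda>q. g q (Z q) (W q))) - Y p (\<lambda>q. X q (\<lambda>q. g q (Z q) (W q)))"
    by (simp add: lie_bracket_def)
  moreover have "g p (R X Y W p) (Z p) = g p (Z p) (R X Y W p)"
    using assms by (intro g_sym) simp_all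
  ultimately show ?thesis
    using assms by (simp add: XY curvature_def g_linear)
qed

text \<open>Without torsion, nested brackets become second covariant derivatives, and the cyclic sum
  is the Jacobi identity.\<close>

lemma first_bianchi:
  assumes "X \<in> \<X>" "Y \<in> \<X>" "Z \<in> \<X>"
  shows "R X Y Z + R Y Z X + R Z X Y = 0"
proof -
  have L: "lie_bracket U (lie_bracket V W) = D U (D V W) - D U (D W V) - D (lie_bracket V W) U"
    if "U \<in> \<X>" "V \<in> \<X>" "W \<in> \<X>" for U V W
  proof -
    have "D U (lie_bracket V W) = D U (D V W) - D U (D W V)"
      using that by (simp add: bracket_eq D_diff2)
    then show ?thesis
      using that by (simp add: bracket_eq[of U "lie_bracket V W"])
  qed
  show ?thesis
    using bracket_jacobi[OF assms] assms by (simp add: L curvature_def algebra_simps)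
qed

text \<open>After the torsion-free pairing \<open>B\<close>, expanding the definition cancels all
  third derivatives; what remains is the derivative of \<open>Z\<close> along a cyclic sum of double
  brackets, which is 0 by Jacobi.\<close>

lemma second_bianchi:
  assumes "W \<in> \<X>" "X \<in> \<X>" "Y \<in> \<X>" "Z \<in> \<X>"
  shows "cov_deriv_curvature D W X Y Z + cov_deriv_curvature D X Y W Z
    + cov_deriv_curvature D Y W X Z = 0"
proof -
  \<comment> \<open>The six terms in which an argument has been differentiated come in pairs, and
    each pair is a curvature with a bracket as its argument.\<close>
  have B: "R (D U V) V' Z + R V' (D V U) Z = R (lie_bracket U V) V' Z"
    if "U \<in> \<X>" "V \<in> \<X>" "V' \<in> \<X>" for U V V'
  proof -
    have "R (D U V) V' Z = R (lie_bracket U V) V' Z + R (D V U) V' Z"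
      using that assms curvature_add1[of "lie_bracket U V" "D V U" V' Z]
      by (simp add: bracket_eq)
    moreover have "R V' (D V U) Z = - R (D V U) V' Z"
      using that assms by (intro curvature_antisym) simp_all
    ultimately show ?thesis by simp
  qed
  have DR: "D U (R V V' Z) = D U (D V (D V' Z)) - D U (D V' (D V Z)) - D U (D (lie_bracket V V') Z)"
    if "U \<in> \<X>" "V \<in> \<X>" "V' \<in> \<X>" for U V V'
    using that assms by (simp add: curvature_def D_diff2)
  have J: "D (lie_bracket (lie_bracket X Y) W) Z + D (lie_bracket (lie_bracket W X) Y) Z
      + D (lie_bracket (lie_bracket Y W) X) Z = 0"
  proof -
    have "lie_bracket (lie_bracket X Y) W + lie_bracket (lie_bracket W X) Y
        + lie_bracket (lie_bracket Y W) X = - (lie_bracket W (lie_bracket X Y)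
        + lie_bracket X (lie_bracket Y W) + lie_bracket Y (lie_bracket W X))"
      using bracket_antisym[of "lie_bracket X Y" W] bracket_antisym[of "lie_bracket W X" Y]
        bracket_antisym[of "lie_bracket Y W" X]
      by (simp add: algebra_simps)
    also have "\<dots> = 0"
      unfolding bracket_jacobi[OF assms(1,2,3)] by simp
    finally have "lie_bracket (lie_bracket X Y) W + lie_bracket (lie_bracket W X) Y
        + lie_bracket (lie_bracket Y W) X = 0" .
    then show ?thesis
      using assms D_zero1[of Z] D_add1 by (metis field_add field_bracket)
  qed
  have "cov_deriv_curvature D W X Y Z + cov_deriv_curvature D X Y W Z
      + cov_deriv_curvature D Y W X Z =
    D W (R X Y Z) + D X (R Y W Z) + D Y (R W X Z)
    - (R X Y (D W Z) + R Y W (D X Z) + R W X (D Y Z))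
    - (R (D W X) Y Z + R Y (D X W) Z) - (R (D Y W) X Z + R X (D W Y) Z)
    - (R (D X Y) W Z + R W (D Y X) Z)"
    by (simp add: cov_deriv_curvature_def algebra_simps)
  also have "\<dots> = D W (R X Y Z) + D X (R Y W Z) + D Y (R W X Z)
    - (R X Y (D W Z) + R Y W (D X Z) + R W X (D Y Z))
    - R (lie_bracket W X) Y Z - R (lie_bracket Y W) X Z - R (lie_bracket X Y) W Z"
    using assms by (simp only: B)
  also have "\<dots> = D (lie_bracket (lie_bracket X Y) W) Z + D (lie_bracket (lie_bracket W X) Y) Z
      + D (lie_bracket (lie_bracket Y W) X) Z"
    using assms by (simp only: DR) (simp add: curvature_def algebra_simps)
  finally show ?thesis using J by simp
qed

end

section \<open>Three-dimensional paracontact metric structures\<close>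

lemma linear_on_sum:
  fixes f :: "'a::real_vector \<Rightarrow> 'b::real_vector"
  assumes "subspace V"
    and "\<And>x y. x \<in> V \<Longrightarrow> y \<in> V \<Longrightarrow> f (x + y) = f x + f y"
    and "\<And>x a. x \<in> V \<Longrightarrow> f (a *\<^sub>R x) = a *\<^sub>R f x"
    and "\<And>i. i \<in> I \<Longrightarrow> e i \<in> V"
  shows "f (\<Sum>i\<in>I. c i *\<^sub>R e i) = (\<Sum>i\<in>I. c i *\<^sub>R f (e i))"
  using assms(4)
proof (induction I rule: infinite_finite_induct)
  case (insert i I)
  then have "(\<Sum>i\<in>I. c i *\<^sub>R e i) \<in> V"
    using assms(1) by (intro subspace_sum subspace_scale) auto
  with insert show ?case
    using assms(1-3) by (simp add: subspace_scale)
qed (use assms(3)[OF subspace_0[OF assms(1)], of 0] in simp_all)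

text \<open>Replaces the arbitrary basis behind \<open>trace_on\<close> by a convenient family. The
  reproducing identity \<open>dual\<close> is enough: expanding each \<open>b\<close> by the
  \<open>e i\<close> and each \<open>L (e i)\<close> by the basis gives the same double sum in two
  orders, as for the trace of a product of two maps.\<close>

lemma trace_on_dual:
  fixes V :: "'v::real_vector set"
  assumes V: "subspace V" and I: "finite I" "\<And>i. i \<in> I \<Longrightarrow> e i \<in> V"
    and \<theta>: "\<And>i x y. x \<in> V \<Longrightarrow> y \<in> V \<Longrightarrow> \<theta> i (x + y) = (\<theta> i x + \<theta> i y :: real)"
      "\<And>i a x. x \<in> V \<Longrightarrow> \<theta> i (a *\<^sub>R x) = a * \<theta> i x"
    and dual: "\<And>x. x \<in> V \<Longrightarrow> x = (\<Sum>i\<in>I. \<theta> i x *\<^sub>R e i)"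
    and L: "\<And>x. x \<in> V \<Longrightarrow> L x \<in> V"
      "\<And>x y. x \<in> V \<Longrightarrow> y \<in> V \<Longrightarrow> L (x + y) = L x + L y"
      "\<And>x a. x \<in> V \<Longrightarrow> L (a *\<^sub>R x) = a *\<^sub>R L x"
  shows "trace_on V L = (\<Sum>i\<in>I. \<theta> i (L (e i)))"
proof -
  define B where "B = (SOME B. independent B \<and> span B = V)"
  have "\<exists>B. independent B \<and> span B = V"
    using basis_exists[of V] span_subspace[OF _ _ V] by metis
  then have B: "independent B" "span B = V"
    unfolding B_def by (metis (mono_tags, lifting) someI_ex)+
  have BV: "b \<in> V" if "b \<in> B" for b
    using that B(2) span_base by blast
  \<comment> \<open>Finiteness of the chosen basis comes from the finite family that spans
    it.\<close>
  have "B \<subseteq> span (e ` I)"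
  proof
    fix b assume "b \<in> B"
    then have "b = (\<Sum>i\<in>I. \<theta> i b *\<^sub>R e i)"
      by (intro dual BV)
    also have "\<dots> \<in> span (e ` I)"
      by (intro span_sum span_scale span_base imageI)
    finally show "b \<in> span (e ` I)" .
  qed
  then have fin: "finite B"
    using independent_span_bound[OF finite_imageI[OF I(1)] B(1)] by blast
  let ?r = "representation B"
  have rep: "?r (x + y) b = ?r x b + ?r y b" "?r (a *\<^sub>R x) b = a *\<^sub>R ?r x b"
    if "x \<in> V" "y \<in> V" for x y a b
    using that B by (simp_all add: representation_add representation_scale)
  have "trace_on V L = (\<Sum>b\<in>B. ?r (L b) b)"
    by (simp add: trace_on_def B_def Let_def)
  also have "\<dots> = (\<Sum>b\<in>B. \<Sum>i\<in>I. ?r (L (e i)) b *\<^sub>R \<theta> i b)"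
  proof (rule sum.cong[OF refl])
    fix b assume "b \<in> B"
    then have "L b = L (\<Sum>i\<in>I. \<theta> i b *\<^sub>R e i)"
      using dual[OF BV] by simp
    also have "\<dots> = (\<Sum>i\<in>I. \<theta> i b *\<^sub>R L (e i))"
      by (rule linear_on_sum[OF V L(2,3) I(2)])
    also have "?r \<dots> b = (\<Sum>i\<in>I. \<theta> i b *\<^sub>R ?r (L (e i)) b)"
      by (rule linear_on_sum[OF V, where f = "\<lambda>x. ?r x b"]) (use rep I(2) L(1) V in \<open>auto simp: subspace_0\<close>)
    finally show "?r (L b) b = (\<Sum>i\<in>I. ?r (L (e i)) b *\<^sub>R \<theta> i b)"
      by (simp add: mult.commute)
  qed
  also have "\<dots> = (\<Sum>i\<in>I. \<Sum>b\<in>B. ?r (L (e i)) b *\<^sub>R \<theta> i b)"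
    by (rule sum.swap)
  also have "\<dots> = (\<Sum>i\<in>I. \<theta> i (L (e i)))"
  proof (rule sum.cong[OF refl])
    fix i assume "i \<in> I"
    then have "L (e i) \<in> span B"
      using I(2) L(1) B(2) by simp
    then have "L (e i) = (\<Sum>b\<in>B. ?r (L (e i)) b *\<^sub>R b)"
      using sum_representation_eq[OF B(1) _ fin order_refl] by simp
    then show "(\<Sum>b\<in>B. ?r (L (e i)) b *\<^sub>R \<theta> i b) = \<theta> i (L (e i))"
      using linear_on_sum[OF V, of "\<theta> i" B "\<lambda>b. b" "?r (L (e i))"] \<theta> BV by simp
  qed
  finally show ?thesis .
qed

lemma dim_1_line:
  fixes V :: "'v::real_vector set"
  assumes "subspace V" "dim V = 1"
  shows "\<exists>a\<in>V. a \<noteq> 0 \<and> (\<forall>x\<in>V. \<exists>t. x = t *\<^sub>R a)"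
proof -
  obtain B where B: "B \<subseteq> V" "independent B" "V \<subseteq> span B" "card B = dim V"
    using basis_exists[of V] by metis
  then obtain a where "B = {a}"
    using assms(2) card_1_singletonE by metis
  with B show ?thesis
    by (intro bexI[of _ a]) (auto simp: span_singleton)
qed

section \<open>Algebra of the structure tensors in dimension 3\<close>

locale paracontact3 = pseudo_riemannian \<A> g D
  for \<A> :: "('m::t2_space, 'e::euclidean_space) chart set"
    and g :: "'m \<Rightarrow> 'm tvec \<Rightarrow> 'm tvec \<Rightarrow> real" and D +
  fixes \<phi> :: "'m \<Rightarrow> 'm tvec \<Rightarrow> 'm tvec" and \<xi> :: "'m vfield" and \<eta> :: "'m \<Rightarrow> 'm tvec \<Rightarrow> real"
  assumes paracontact: "paracontact_metric_structure 1 \<A> \<phi> \<xi> \<eta> g"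
begin

lemma almost_paracontact: "almost_paracontact_structure 1 \<A> \<phi> \<xi> \<eta>"
  using paracontact by (simp add: paracontact_metric_structure_def)

lemma DIM3: "DIM('e) = 3"
  using almost_paracontact by (simp add: almost_paracontact_structure_def)

lemma \<xi>_field [simp]: "\<xi> \<in> \<X>"
  using almost_paracontact by (simp add: almost_paracontact_structure_def)

lemma
  assumes "x \<in> \<T> p"
  shows \<phi>_tangent [simp]: "\<phi> p x \<in> \<T> p"
    and \<phi>_add: "y \<in> \<T> p \<Longrightarrow> \<phi> p (x + y) = \<phi> p x + \<phi> p y"
    and \<phi>_scale: "\<phi> p (a *\<^sub>R x) = a *\<^sub>R \<phi> p x"
  using almost_paracontact assms
  by (simp_all add: almost_paracontact_structure_def tensor_field_1_1_def)

lemma \<phi>_field [simp]: "X \<in> \<X> \<Longrightarrow> (\<lambda>q. \<phi> q (X q)) \<in> \<X>"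
  using almost_paracontact by (simp add: almost_paracontact_structure_def tensor_field_1_1_def)

lemma
  assumes "x \<in> \<T> p"
  shows \<eta>_add: "y \<in> \<T> p \<Longrightarrow> \<eta> p (x + y) = \<eta> p x + \<eta> p y"
    and \<eta>_scale: "\<eta> p (a *\<^sub>R x) = a * \<eta> p x"
  using almost_paracontact assms
  by (simp_all add: almost_paracontact_structure_def one_form_def)

lemma \<eta>_smooth [simp]: "X \<in> \<X> \<Longrightarrow> (\<lambda>q. \<eta> q (X q)) \<in> \<F>"
  using almost_paracontact by (simp add: almost_paracontact_structure_def one_form_def)

lemma \<phi>_\<xi> [simp]: "\<phi> p (\<xi> p) = 0" and \<eta>_\<xi> [simp]: "\<eta> p (\<xi> p) = 1"
  using almost_paracontact by (simp_all add: almost_paracontact_structure_def)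

lemma
  assumes "x \<in> \<T> p"
  shows \<eta>_\<phi>: "\<eta> p (\<phi> p x) = 0" and \<phi>_\<phi>: "\<phi> p (\<phi> p x) = x - \<eta> p x *\<^sub>R \<xi> p"
  using almost_paracontact assms by (simp_all add: almost_paracontact_structure_def)

lemma \<phi>_zero [simp]: "\<phi> p 0 = 0"
  using \<phi>_scale[of 0 p 0] by simp

lemma \<eta>_zero [simp]: "\<eta> p 0 = 0"
  using \<eta>_scale[of 0 p 0] by simp

lemma \<eta>_neg: "x \<in> \<T> p \<Longrightarrow> \<eta> p (- x) = - \<eta> p x"
  using \<eta>_scale[of x p "-1"] by simp

lemma \<eta>_diff: "x \<in> \<T> p \<Longrightarrow> y \<in> \<T> p \<Longrightarrow> \<eta> p (x - y) = \<eta> p x - \<eta> p y"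
  using \<eta>_add[of x p "- y"] by (simp add: \<eta>_neg)

lemma \<phi>_neg: "x \<in> \<T> p \<Longrightarrow> \<phi> p (- x) = - \<phi> p x"
  using \<phi>_scale[of x p "-1"] by simp

lemma \<phi>_diff: "x \<in> \<T> p \<Longrightarrow> y \<in> \<T> p \<Longrightarrow> \<phi> p (x - y) = \<phi> p x - \<phi> p y"
  using \<phi>_add[of x p "- y"] by (simp add: \<phi>_neg)

lemma g_\<phi>_\<phi>:
  "x \<in> \<T> p \<Longrightarrow> y \<in> \<T> p \<Longrightarrow> g p (\<phi> p x) (\<phi> p y) = - g p x y + \<eta> p x * \<eta> p y"
  using paracontact by (simp add: paracontact_metric_structure_def compatible_metric_def)

lemma d\<eta>:
  "X \<in> \<X> \<Longrightarrow> Y \<in> \<X> \<Longrightarrow> g p (X p) (\<phi> p (Y p)) = exterior_derivative \<eta> X Y p"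
  using paracontact by (simp add: paracontact_metric_structure_def)

lemma g_\<xi>: "x \<in> \<T> p \<Longrightarrow> g p x (\<xi> p) = \<eta> p x"
  using g_\<phi>_\<phi>[of x p "\<xi> p"] by (simp add: g_zero2)

lemma g_\<xi>': "x \<in> \<T> p \<Longrightarrow> g p (\<xi> p) x = \<eta> p x"
  using g_\<xi>[of x p] by (simp add: g_sym)

lemma g_\<phi>:
  assumes "x \<in> \<T> p" "y \<in> \<T> p"
  shows "g p (\<phi> p x) y = - g p x (\<phi> p y)"
  using g_\<phi>_\<phi>[of x p "\<phi> p y"] assms by (simp add: \<eta>_\<phi> \<phi>_\<phi> g_linear g_\<xi>)

lemma contact: "X \<in> \<X> \<Longrightarrow> Y \<in> \<X> \<Longrightarrow>
    X p (\<lambda>q. \<eta> q (Y q)) - Y p (\<lambda>q. \<eta> q (X q)) - \<eta> p (lie_bracket X Y p) = 2 * g p (X p) (\<phi> p (Y p))"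
  by (simp add: d\<eta> exterior_derivative_def)

text \<open>Either vector may be \<open>0\<close>; together with \<open>\<xi>\<close> they form a basis iff \<open>g p a b \<noteq> 0\<close>.\<close>

definition null_pair :: "'m \<Rightarrow> 'm tvec \<Rightarrow> 'm tvec \<Rightarrow> bool"
  where "null_pair p a b \<longleftrightarrow> a \<in> \<T> p \<and> b \<in> \<T> p \<and> \<eta> p a = 0 \<and> \<eta> p b = 0 \<and>
    \<phi> p a = a \<and> \<phi> p b = - b"

section \<open>Null bases, null frames and tensoriality\<close>

lemma null_pairD:
  assumes "null_pair p a b"
  shows "a \<in> \<T> p" "b \<in> \<T> p" "\<eta> p a = 0" "\<eta> p b = 0" "\<phi> p a = a" "\<phi> p b = - b"
    "g p a a = 0" "g p b b = 0" "g p b a = g p a b"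
    "g p a (\<xi> p) = 0" "g p b (\<xi> p) = 0" "g p (\<xi> p) a = 0" "g p (\<xi> p) b = 0"
  \<comment> \<open>Skewness of \<phi> makes its eigenvectors null:
    \<open>g p (\<phi> p a) a\<close> is both \<open>g p a a\<close> and its negative.\<close>
  using assms g_\<phi>[of a p a] g_\<phi>[of b p b] g_sym[of a p b]
  by (auto simp: null_pair_def g_\<xi> g_\<xi>' g_linear)

text \<open>On ker \<eta> the map \<phi> is an involution, so a horizontal \<open>y\<close> is the
  sum of the halves of \<open>y + \<phi> p y\<close> and \<open>y - \<phi> p y\<close>; these lie in
  eigenspaces that are lines because n = 1.\<close>

lemma null_basis_exists:
  obtains a b where "null_pair p a b" "a \<noteq> 0" "b \<noteq> 0"
    "\<And>x. x \<in> \<T> p \<Longrightarrow> \<exists>s t. x = \<eta> p x *\<^sub>R \<xi> p + s *\<^sub>R a + t *\<^sub>R b"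
proof -
  let ?P = "{x\<in>\<T> p. \<eta> p x = 0 \<and> \<phi> p x = x}" and ?N = "{x\<in>\<T> p. \<eta> p x = 0 \<and> \<phi> p x = - x}"
  have sub: "subspace ?P" "subspace ?N"
    by (rule subspaceI; auto simp: \<eta>_add \<eta>_scale \<phi>_add \<phi>_scale)+
  have dim: "dim ?P = 1" "dim ?N = 1"
    using almost_paracontact by (simp_all add: almost_paracontact_structure_def)
  obtain a where a: "a \<in> ?P" "a \<noteq> 0" "\<forall>x\<in>?P. \<exists>t. x = t *\<^sub>R a"
    using dim_1_line[OF sub(1) dim(1)] by (elim bexE conjE) (rule that)
  obtain b where b: "b \<in> ?N" "b \<noteq> 0" "\<forall>x\<in>?N. \<exists>t. x = t *\<^sub>R b"
    using dim_1_line[OF sub(2) dim(2)] by (elim bexE conjE) (rule that)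
  show ?thesis
  proof (rule that[of a b])
    show "null_pair p a b"
      using a b by (simp add: null_pair_def)
    fix x assume x: "x \<in> \<T> p"
    define y where "y = x - \<eta> p x *\<^sub>R \<xi> p"
    have y: "y \<in> \<T> p" "\<eta> p y = 0" "\<phi> p (\<phi> p y) = y"
      using x by (simp_all add: y_def \<eta>_diff \<eta>_scale \<phi>_\<phi>)
    have "(1/2) *\<^sub>R (y + \<phi> p y) \<in> ?P"
      using y by (simp add: \<eta>_scale \<eta>_add \<eta>_\<phi> \<phi>_scale \<phi>_add add.commute)
    then obtain s where s: "(1/2) *\<^sub>R (y + \<phi> p y) = s *\<^sub>R a"
      using a(3) by blast
    have "(1/2) *\<^sub>R (y - \<phi> p y) \<in> ?N"
      using y by (simp add: \<eta>_scale \<eta>_add \<eta>_diff \<eta>_\<phi> \<phi>_scale \<phi>_diff flip: scaleR_minus_right)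
    then obtain t where t: "(1/2) *\<^sub>R (y - \<phi> p y) = t *\<^sub>R b"
      using b(3) by blast
    have "y = (1/2) *\<^sub>R (y + \<phi> p y) + (1/2) *\<^sub>R (y - \<phi> p y)"
      by (simp add: algebra_simps flip: scaleR_add_left)
    then have "y = s *\<^sub>R a + t *\<^sub>R b"
      using s t by simp
    then show "\<exists>s t. x = \<eta> p x *\<^sub>R \<xi> p + s *\<^sub>R a + t *\<^sub>R b"
      unfolding y_def by (intro exI[of _ s] exI[of _ t]) (simp add: algebra_simps)
  qed (use a b in auto)
qed

text \<open>The dimension bound for the counting argument: three vectors span by
  \<open>null_basis_exists\<close>, and the charts have dimension 3.\<close>

lemma extension_exists: "x \<in> \<T> p \<Longrightarrow> \<exists>X\<in>\<X>. X p = x"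
proof -
  assume x: "x \<in> \<T> p"
  obtain a b where ab: "\<And>x. x \<in> \<T> p \<Longrightarrow> \<exists>s t. x = \<eta> p x *\<^sub>R \<xi> p + s *\<^sub>R a + t *\<^sub>R b"
    using null_basis_exists by metis
  have "\<T> p \<subseteq> span {\<xi> p, a, b}"
  proof
    fix x assume "x \<in> \<T> p"
    then obtain s t where "x = \<eta> p x *\<^sub>R \<xi> p + s *\<^sub>R a + t *\<^sub>R b"
      using ab by blast
    also have "\<dots> \<in> span {\<xi> p, a, b}"
      by (intro span_add span_scale span_base) auto
    finally show "x \<in> span {\<xi> p, a, b}" .
  qed
  moreover have "card {\<xi> p, a, b} \<le> DIM('e)"
    unfolding DIM3 by (rule order_trans[OF card_insert_le_m1[of 3]]) (auto intro!: card_insert_le_m1)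
  ultimately show ?thesis
    using extension_exists_if_spanned[of "{\<xi> p, a, b}"] x by blast
qed

text \<open>Both sides are bilinear in the pair, and each member is a multiple, possibly 0, of a
  spanning eigenvector \<open>u\<close> or \<open>v\<close>. Hence it suffices to read off the
  coefficients of \<open>x\<close> by pairing with \<open>v\<close> and \<open>u\<close>.\<close>

lemma null_expansion:
  assumes "null_pair p a b" "x \<in> \<T> p"
  shows "g p a b *\<^sub>R x = (g p a b * \<eta> p x) *\<^sub>R \<xi> p + g p x b *\<^sub>R a + g p x a *\<^sub>R b"
proof -
  obtain u v where uv: "null_pair p u v" "u \<noteq> 0" "v \<noteq> 0"
    and ex: "\<And>x. x \<in> \<T> p \<Longrightarrow> \<exists>s t. x = \<eta> p x *\<^sub>R \<xi> p + s *\<^sub>R u + t *\<^sub>R v"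
    using null_basis_exists by metis
  note ab = null_pairD[OF assms(1)] and uv' = null_pairD[OF uv(1)]
  obtain s t where st0: "x = \<eta> p x *\<^sub>R \<xi> p + s *\<^sub>R u + t *\<^sub>R v"
    using ex[OF assms(2)] by blast
  define e where "e = \<eta> p x"
  have st: "x = e *\<^sub>R \<xi> p + s *\<^sub>R u + t *\<^sub>R v"
    using st0 by (simp add: e_def)
  obtain a1 a2 where a: "a = a1 *\<^sub>R u + a2 *\<^sub>R v"
    using ex[OF ab(1)] ab(3) by auto
  obtain b1 b2 where b: "b = b1 *\<^sub>R u + b2 *\<^sub>R v"
    using ex[OF ab(2)] ab(4) by auto
  have "\<phi> p (a2 *\<^sub>R v) = - a2 *\<^sub>R v" "\<phi> p (b1 *\<^sub>R u) = b1 *\<^sub>R u"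
    using uv' by (simp_all add: \<phi>_scale)
  moreover have "\<phi> p (a1 *\<^sub>R u) = a1 *\<^sub>R u" "\<phi> p (b2 *\<^sub>R v) = - b2 *\<^sub>R v"
    using uv' by (simp_all add: \<phi>_scale)
  ultimately have "a1 *\<^sub>R u - a2 *\<^sub>R v = a1 *\<^sub>R u + a2 *\<^sub>R v" "b1 *\<^sub>R u - b2 *\<^sub>R v = - b1 *\<^sub>R u - b2 *\<^sub>R v"
    using ab(5,6) uv'(1,2) by (simp_all add: a b \<phi>_add)
  then have "2 *\<^sub>R (a2 *\<^sub>R v) = 0" "2 *\<^sub>R (b1 *\<^sub>R u) = 0"
    unfolding scaleR_2 by (simp_all add: algebra_simps)
  then have z: "a2 = 0" "b1 = 0"
    using uv(2,3) by simp_all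
  have xu: "g p x u = t * g p u v" "g p x v = s * g p u v"
    unfolding st using uv' by (simp_all add: g_linear)
  show ?thesis
    unfolding e_def[symmetric]
    using uv' assms(2) by (simp add: a b z g_linear xu) (simp add: st algebra_simps)
qed

text \<open>If the product were 0, the expansion would be a relation between \<open>a\<close> and
  \<open>b\<close> for every \<open>x\<close>. Applying \<phi> flips the sign of the
  \<open>b\<close> term, so both terms vanish; then every \<open>x\<close> is orthogonal to
  \<open>a\<close>, against nondegeneracy.\<close>

lemma null_basis_nondegenerate:
  assumes "null_pair p a b" "a \<noteq> 0" "b \<noteq> 0"
  shows "g p a b \<noteq> 0"
proof
  assume "g p a b = 0"
  then have *: "g p x b *\<^sub>R a + g p x a *\<^sub>R b = 0" if "x \<in> \<T> p" for x
    using null_expansion[OF assms(1) that] by simp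
  note ab = null_pairD[OF assms(1)]
  have "g p a x = 0" if x: "x \<in> \<T> p" for x
  proof -
    have "\<phi> p (g p x b *\<^sub>R a + g p x a *\<^sub>R b) = 0"
      using *[OF x] by simp
    then have "g p x b *\<^sub>R a - g p x a *\<^sub>R b = 0"
      using ab by (simp add: \<phi>_add \<phi>_scale)
    then have "2 *\<^sub>R (g p x a *\<^sub>R b) = 0"
      using *[OF x] unfolding scaleR_2 by (simp add: algebra_simps)
    then show ?thesis
      using assms(3) g_sym[OF ab(1) x] by simp
  qed
  then show False
    using g_nondegenerate[OF ab(1)] assms(2) by blast
qed

definition null_frame :: "'m vfield \<Rightarrow> 'm vfield \<Rightarrow> bool"
  where "null_frame P N \<longleftrightarrow> P \<in> \<X> \<and> N \<in> \<X> \<and> (\<forall>q. null_pair q (P q) (N q))"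

text \<open>Half of \<phi>^2 + \<phi> and half of \<phi>^2 - \<phi> project onto the eigenlines at
  every point. Applied to arbitrary extensions of \<open>a\<close> and \<open>b\<close> they give
  global fields, nondegenerate at \<open>p\<close> but perhaps not elsewhere.\<close>

lemma null_frame_exists:
  obtains P N where "null_frame P N" "g p (P p) (N p) \<noteq> 0"
proof -
  obtain a b where ab: "null_pair p a b" "a \<noteq> 0" "b \<noteq> 0"
    using null_basis_exists by metis
  note ab' = null_pairD[OF ab(1)]
  obtain A B where AB: "A \<in> \<X>" "A p = a" "B \<in> \<X>" "B p = b"
    using extension_exists ab'(1,2) by metis
  define P where "P = (\<lambda>q. (1/2) *\<^sub>R ((\<lambda>q. \<phi> q (\<phi> q (A q))) + (\<lambda>q. \<phi> q (A q))) q)"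
  define N where "N = (\<lambda>q. (1/2) *\<^sub>R ((\<lambda>q. \<phi> q (\<phi> q (B q))) - (\<lambda>q. \<phi> q (B q))) q)"
  have \<phi>3: "\<phi> q (\<phi> q (\<phi> q x)) = \<phi> q x" if "x \<in> \<T> q" for q x
    using that by (simp add: \<phi>_\<phi>[of "\<phi> q x"] \<eta>_\<phi>)
  have "P \<in> \<X>" "N \<in> \<X>"
    unfolding P_def N_def using AB by (intro field_scale smooth_const field_add field_diff \<phi>_field; simp)+
  moreover have "null_pair q (P q) (N q)" for q
    using AB by (simp add: null_pair_def P_def N_def \<eta>_scale \<eta>_add \<eta>_diff \<eta>_\<phi> \<phi>_scale \<phi>_add \<phi>_diff \<phi>3 algebra_simps)
  ultimately have "null_frame P N"
    by (simp add: null_frame_def)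
  moreover have "P p = a" "N p = b"
    using ab' AB by (simp_all add: P_def N_def \<phi>_\<phi> flip: scaleR_2 scaleR_left_distrib)
  ultimately show ?thesis
    using that null_basis_nondegenerate[OF ab] by metis
qed

text \<open>The expansion of \<rho> times a field in a null frame has global smooth coefficients,
  and \<open>scale\<close> evaluates them at \<open>p\<close>. So \<rho> p times \<open>L X\<close>
  depends on \<open>X p\<close> only, and \<rho> p can be cancelled.\<close>

lemma tensorial:
  fixes L :: "'m vfield \<Rightarrow> 'v::real_vector"
  assumes add: "\<And>X Y. X \<in> \<X> \<Longrightarrow> Y \<in> \<X> \<Longrightarrow> L (X + Y) = L X + L Y"
    and scale: "\<And>X f. f \<in> \<F> \<Longrightarrow> X \<in> \<X> \<Longrightarrow> L (\<lambda>q. f q *\<^sub>R X q) = f p *\<^sub>R L X"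
    and XY: "X \<in> \<X>" "Y \<in> \<X>" "X p = Y p"
  shows "L X = L Y"
proof -
  obtain P N where PN: "null_frame P N" "g p (P p) (N p) \<noteq> 0"
    using null_frame_exists .
  define \<rho> where "\<rho> q = g q (P q) (N q)" for q
  have f [simp]: "P \<in> \<X>" "N \<in> \<X>" "\<rho> \<in> \<F>"
    using PN(1) by (simp_all add: null_frame_def \<rho>_def[abs_def])
  have exp: "\<rho> p *\<^sub>R L X = (\<rho> p * \<eta> p (X p)) *\<^sub>R L \<xi> + g p (X p) (N p) *\<^sub>R L P + g p (X p) (P p) *\<^sub>R L N"
    if [simp]: "X \<in> \<X>" for X
  proof -
    have "(\<lambda>q. \<rho> q *\<^sub>R X q) = (\<lambda>q. (\<rho> q * \<eta> q (X q)) *\<^sub>R \<xi> q)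
        + (\<lambda>q. g q (X q) (N q) *\<^sub>R P q) + (\<lambda>q. g q (X q) (P q) *\<^sub>R N q)"
    proof
      fix q
      have "null_pair q (P q) (N q)"
        using PN(1) by (simp add: null_frame_def)
      from null_expansion[OF this, of "X q"]
      show "\<rho> q *\<^sub>R X q = ((\<lambda>q. (\<rho> q * \<eta> q (X q)) *\<^sub>R \<xi> q)
        + (\<lambda>q. g q (X q) (N q) *\<^sub>R P q) + (\<lambda>q. g q (X q) (P q) *\<^sub>R N q)) q"
        by (simp add: \<rho>_def)
    qed
    then have "L (\<lambda>q. \<rho> q *\<^sub>R X q) = L (\<lambda>q. (\<rho> q * \<eta> q (X q)) *\<^sub>R \<xi> q)
        + L (\<lambda>q. g q (X q) (N q) *\<^sub>R P q) + L (\<lambda>q. g q (X q) (P q) *\<^sub>R N q)"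
      by (simp add: add smooth_mult)
    then show ?thesis
      by (simp add: scale smooth_mult)
  qed
  have "\<rho> p *\<^sub>R L X = \<rho> p *\<^sub>R L Y"
    unfolding exp[OF XY(1)] exp[OF XY(2)] XY(3) ..
  then show ?thesis
    using PN(2) by (simp add: \<rho>_def)
qed

section \<open>Curvature, Ricci tensor and Ricci operator at a point\<close>

lemma extension_props:
  assumes "x \<in> \<T> p"
  shows "extension \<A> p x \<in> \<X>" "extension \<A> p x p = x"
proof -
  have "\<exists>X. X \<in> \<X> \<and> X p = x"
    using extension_exists[OF assms] by blast
  from someI_ex[OF this] show "extension \<A> p x \<in> \<X>" "extension \<A> p x p = x"
    by (simp_all add: extension_def)
qed

lemma curvature_pointwise:
  assumes "X \<in> \<X>" "Y \<in> \<X>" "Z \<in> \<X>" "X' \<in> \<X>" "Y' \<in> \<X>" "Z' \<in> \<X>"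
    and "X p = X' p" "Y p = Y' p" "Z p = Z' p"
  shows "R X Y Z p = R X' Y' Z' p"
proof -
  have 1: "R X Y Z p = R X' Y Z p"
    if "X \<in> \<X>" "Y \<in> \<X>" "Z \<in> \<X>" "X' \<in> \<X>" "X p = X' p" for X X' Y Z
    by (rule tensorial[of "\<lambda>X. R X Y Z p" p, OF _ _ that(1,4,5)])
      (simp_all add: that curvature_add1 curvature_scale1)
  have "R X Y Z p = R X' Y Z p"
    using assms by (intro 1) simp_all
  \<comment> \<open>The second argument is moved to the first slot by antisymmetry, replaced there,
    and moved back.\<close>
  also have "\<dots> = - R Y X' Z p"
    using curvature_antisym[of Y X' Z] assms by simp
  also have "R Y X' Z p = R Y' X' Z p"
    using assms by (intro 1) simp_all
  also have "- \<dots> = R X' Y' Z p"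
    using curvature_antisym[of Y' X' Z] assms by simp
  also have "\<dots> = R X' Y' Z' p"
    by (rule tensorial[of "\<lambda>Z. R X' Y' Z p" p, OF _ _ assms(3,6,9)])
      (simp_all add: assms curvature_add3 curvature_scale3)
  finally show ?thesis .
qed

abbreviation "r \<equiv> curvature_at \<A> D"

text \<open>Frees \<open>curvature_at\<close> from the extensions chosen in its definition.\<close>

lemma curvature_at_eq:
  assumes "X \<in> \<X>" "Y \<in> \<X>" "Z \<in> \<X>"
  shows "r p (X p) (Y p) (Z p) = R X Y Z p"
  unfolding curvature_at_def
  using assms by (intro curvature_pointwise) (simp_all add: extension_props)

lemma
  assumes "x \<in> \<T> p" "y \<in> \<T> p" "z \<in> \<T> p"
  shows r_closed [simp]: "r p x y z \<in> \<T> p"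
    and r_antisym: "r p y x z = - r p x y z"
    and r_add1: "w \<in> \<T> p \<Longrightarrow> r p (x + w) y z = r p x y z + r p w y z"
    and r_scale1: "r p (t *\<^sub>R x) y z = t *\<^sub>R r p x y z"
    and r_add3: "w \<in> \<T> p \<Longrightarrow> r p x y (z + w) = r p x y z + r p x y w"
    and r_scale3: "r p x y (t *\<^sub>R z) = t *\<^sub>R r p x y z"
    and r_skew: "w \<in> \<T> p \<Longrightarrow> g p (r p x y z) w = - g p (r p x y w) z"
    and r_bianchi: "r p x y z + r p y z x + r p z x y = 0"
proof -
  obtain X Y Z where XYZ: "X \<in> \<X>" "Y \<in> \<X>" "Z \<in> \<X>" "X p = x" "Y p = y" "Z p = z"
    using assms extension_exists by metis
  note eq = curvature_at_eq[symmetric]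
  show "r p x y z \<in> \<T> p"
    using curvature_at_eq[of X Y Z p] XYZ by simp
  show "r p y x z = - r p x y z"
    using curvature_antisym[of X Y Z] XYZ eq[of X Y Z p] eq[of Y X Z p] by simp
  show "r p (t *\<^sub>R x) y z = t *\<^sub>R r p x y z"
    using curvature_scale1[of X Y Z "\<lambda>q. t" p] XYZ eq[of X Y Z p] eq[of "\<lambda>q. t *\<^sub>R X q" Y Z p] by simp
  show "r p x y (t *\<^sub>R z) = t *\<^sub>R r p x y z"
    using curvature_scale3[of X Y Z "\<lambda>q. t" p] XYZ eq[of X Y Z p] eq[of X Y "\<lambda>q. t *\<^sub>R Z q" p] by simp
  have "(R X Y Z + R Y Z X + R Z X Y) p = 0 p"
    using first_bianchi[of X Y Z] XYZ by simp
  then show "r p x y z + r p y z x + r p z x y = 0"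
    using XYZ eq[of X Y Z p] eq[of Y Z X p] eq[of Z X Y p] by simp
  assume "w \<in> \<T> p"
  then obtain W where W: "W \<in> \<X>" "W p = w"
    using extension_exists by metis
  show "r p (x + w) y z = r p x y z + r p w y z"
    using curvature_add1[of X W Y Z] W XYZ eq[of X Y Z p] eq[of W Y Z p] eq[of "X + W" Y Z p] by simp
  show "r p x y (z + w) = r p x y z + r p x y w"
    using curvature_add3[of X W Y Z] W XYZ eq[of X Y Z p] eq[of X Y W p] eq[of X Y "Z + W" p] by simp
  show "g p (r p x y z) w = - g p (r p x y w) z"
    using curvature_skew[of X Y Z W p] W XYZ eq[of X Y Z p] eq[of X Y W p] by simp
qed

lemma
  assumes "x \<in> \<T> p" "y \<in> \<T> p" "z \<in> \<T> p"
  shows r_add2: "w \<in> \<T> p \<Longrightarrow> r p x (y + w) z = r p x y z + r p x w z"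
    and r_scale2: "r p x (t *\<^sub>R y) z = t *\<^sub>R r p x y z"
  using assms by (simp_all add: r_antisym[of _ p x] r_add1 r_scale1)

lemmas r_linear = r_add1 r_add2 r_add3 r_scale1 r_scale2 r_scale3

lemma r_self:
  assumes "x \<in> \<T> p" "z \<in> \<T> p"
  shows "r p x x z = 0"
proof -
  have "2 *\<^sub>R r p x x z = 0"
    unfolding scaleR_2 using r_antisym[of x p x z] assms by (metis add.right_inverse)
  then show ?thesis by simp
qed

lemma null_decomposition:
  assumes "null_pair p a b" "g p a b \<noteq> 0" "x \<in> \<T> p"
  shows "x = \<eta> p x *\<^sub>R \<xi> p + (g p x b / g p a b) *\<^sub>R a + (g p x a / g p a b) *\<^sub>R b"
proof -
  have "x = inverse (g p a b) *\<^sub>R (g p a b *\<^sub>R x)"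
    using assms(2) by simp
  also have "\<dots> = \<eta> p x *\<^sub>R \<xi> p + (g p x b / g p a b) *\<^sub>R a + (g p x a / g p a b) *\<^sub>R b"
    unfolding null_expansion[OF assms(1,3)] using assms(2)
    by (simp add: scaleR_add_right divide_inverse mult.commute)
  finally show ?thesis .
qed

lemma linear_zero_on_basis:
  fixes f :: "'m tvec \<Rightarrow> 'v::real_vector"
  assumes "null_pair p a b" "g p a b \<noteq> 0"
    and add: "\<And>x y. x \<in> \<T> p \<Longrightarrow> y \<in> \<T> p \<Longrightarrow> f (x + y) = f x + f y"
    and scale: "\<And>x t. x \<in> \<T> p \<Longrightarrow> f (t *\<^sub>R x) = t *\<^sub>R f x"
    and "f (\<xi> p) = 0" "f a = 0" "f b = 0" "x \<in> \<T> p"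
  shows "f x = 0"
  using assms(5-8) null_pairD(1,2)[OF assms(1)]
  by (subst null_decomposition[OF assms(1,2,8)]) (simp add: add scale)

lemma trace_tangent:
  assumes ab: "null_pair p a b" "g p a b \<noteq> 0"
    and L: "\<And>x. x \<in> \<T> p \<Longrightarrow> L x \<in> \<T> p"
      "\<And>x y. x \<in> \<T> p \<Longrightarrow> y \<in> \<T> p \<Longrightarrow> L (x + y) = L x + L y"
      "\<And>x t. x \<in> \<T> p \<Longrightarrow> L (t *\<^sub>R x) = t *\<^sub>R L x"
  shows "trace_on (\<T> p) L = \<eta> p (L (\<xi> p)) + (g p (L a) b + g p (L b) a) / g p a b"
proof -
  note ab' = null_pairD[OF ab(1)]
  define e where "e i = (if i = 0 then \<xi> p else if i = 1 then a else b)" for i :: nat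
  \<comment> \<open>As \<open>a\<close> and \<open>b\<close> are null, the coefficient of each is
    found by pairing with the other.\<close>
  define \<theta> where "\<theta> i x = (if i = 0 then \<eta> p x else if i = 1 then g p x b / g p a b else g p x a / g p a b)"
    for i :: nat and x
  have "trace_on (\<T> p) L = (\<Sum>i\<in>{0,1,2}. \<theta> i (L (e i)))"
  proof (rule trace_on_dual[OF subspace_tangent_space _ _ _ _ _ L])
    show "x = (\<Sum>i\<in>{0,1,2}. \<theta> i x *\<^sub>R e i)" if "x \<in> \<T> p" for x
      using null_decomposition[OF ab that] by (simp add: \<theta>_def e_def add.assoc)
    show "\<theta> i (x + y) = \<theta> i x + \<theta> i y" if "x \<in> \<T> p" "y \<in> \<T> p" for i x y
      using ab' that by (simp add: \<theta>_def \<eta>_add g_linear add_divide_distrib)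
  qed (use ab' in \<open>auto simp: e_def \<theta>_def \<eta>_scale g_linear\<close>)
  then show ?thesis
    by (simp add: \<theta>_def e_def add_divide_distrib)
qed

abbreviation "Rm p x y z w \<equiv> g p (r p x y z) w"

lemma ricci_eq:
  assumes "null_pair p a b" "g p a b \<noteq> 0" "y \<in> \<T> p" "z \<in> \<T> p"
  shows "ricci \<A> D p y z = Rm p (\<xi> p) y z (\<xi> p) + (Rm p a y z b + Rm p b y z a) / g p a b"
  unfolding ricci_def using assms null_pairD(1,2)[OF assms(1)]
  by (subst trace_tangent[OF assms(1,2)]) (simp_all add: r_linear g_\<xi>)

lemma
  assumes "y \<in> \<T> p" "z \<in> \<T> p"
  shows ricci_add1: "w \<in> \<T> p \<Longrightarrow> ricci \<A> D p (y + w) z = ricci \<A> D p y z + ricci \<A> D p w z"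
    and ricci_scale1: "ricci \<A> D p (t *\<^sub>R y) z = t * ricci \<A> D p y z"
    and ricci_add2: "w \<in> \<T> p \<Longrightarrow> ricci \<A> D p y (z + w) = ricci \<A> D p y z + ricci \<A> D p y w"
    and ricci_scale2: "ricci \<A> D p y (t *\<^sub>R z) = t * ricci \<A> D p y z"
proof -
  obtain a b where ab: "null_pair p a b" "g p a b \<noteq> 0"
    using null_basis_exists null_basis_nondegenerate by metis
  note [simp] = null_pairD(1,2)[OF ab(1)] assms ricci_eq[OF ab] r_linear g_linear
  show "ricci \<A> D p (t *\<^sub>R y) z = t * ricci \<A> D p y z" "ricci \<A> D p y (t *\<^sub>R z) = t * ricci \<A> D p y z"
    by (simp_all add: distrib_left add_divide_distrib)
  assume [simp]: "w \<in> \<T> p"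
  show "ricci \<A> D p (y + w) z = ricci \<A> D p y z + ricci \<A> D p w z"
    "ricci \<A> D p y (z + w) = ricci \<A> D p y z + ricci \<A> D p y w"
    by (simp_all add: add_divide_distrib)
qed

abbreviation "Q \<equiv> ricci_operator \<A> g D"

lemma
  assumes "x \<in> \<T> p"
  shows Q_closed [simp]: "Q p x \<in> \<T> p"
    and g_Q: "y \<in> \<T> p \<Longrightarrow> g p (Q p x) y = ricci \<A> D p x y"
proof -
  obtain a b where ab: "null_pair p a b" "g p a b \<noteq> 0"
    using null_basis_exists null_basis_nondegenerate by metis
  note ab' = null_pairD[OF ab(1)]
  \<comment> \<open>The vector dual to the Ricci form at \<open>x\<close>, with the coefficients of
    \<open>a\<close> and \<open>b\<close> crossed because the basis is null; it witnesses the
    existence behind \<open>THE\<close>, and nondegeneracy gives uniqueness.\<close>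
  define q where "q = ricci \<A> D p x (\<xi> p) *\<^sub>R \<xi> p + (ricci \<A> D p x b / g p a b) *\<^sub>R a
    + (ricci \<A> D p x a / g p a b) *\<^sub>R b"
  have q: "q \<in> \<T> p"
    using ab' by (simp add: q_def)
  have "g p q y - ricci \<A> D p x y = 0" if "y \<in> \<T> p" for y
  proof (rule linear_zero_on_basis[OF ab _ _ _ _ _ that])
    show "g p q (y + z) - ricci \<A> D p x (y + z) =
        (g p q y - ricci \<A> D p x y) + (g p q z - ricci \<A> D p x z)"
      if "y \<in> \<T> p" "z \<in> \<T> p" for y z
      using that q assms by (simp add: g_linear ricci_add2)
    show "g p q (t *\<^sub>R y) - ricci \<A> D p x (t *\<^sub>R y) = t *\<^sub>R (g p q y - ricci \<A> D p x y)"
      if "y \<in> \<T> p" for y t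
      using that q assms by (simp add: g_linear ricci_scale2 algebra_simps)
    have "g p (\<xi> p) (\<xi> p) = 1"
      by (simp add: g_\<xi>)
    then show "g p q (\<xi> p) - ricci \<A> D p x (\<xi> p) = 0" "g p q a - ricci \<A> D p x a = 0"
      "g p q b - ricci \<A> D p x b = 0"
      using ab' ab(2) by (simp_all add: q_def g_linear)
  qed
  then have *: "q \<in> \<T> p \<and> (\<forall>y\<in>\<T> p. g p q y = ricci \<A> D p x y)"
    using q by simp
  moreover have "q' = q" if "q' \<in> \<T> p \<and> (\<forall>y\<in>\<T> p. g p q' y = ricci \<A> D p x y)" for q'
    using that * by (intro g_unique[of q' p q]) simp_all
  ultimately have "Q p x = q"
    unfolding ricci_operator_def by (rule the_equality)
  then show "Q p x \<in> \<T> p" "y \<in> \<T> p \<Longrightarrow> g p (Q p x) y = ricci \<A> D p x y"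
    using * by simp_all
qed

lemma
  assumes "x \<in> \<T> p"
  shows Q_add: "y \<in> \<T> p \<Longrightarrow> Q p (x + y) = Q p x + Q p y"
    and Q_scale: "Q p (t *\<^sub>R x) = t *\<^sub>R Q p x"
  using assms by (auto intro!: g_unique[of _ p] simp: g_linear g_Q ricci_add1 ricci_scale1)

lemma scalar_curvature_eq:
  assumes "null_pair p a b" "g p a b \<noteq> 0"
  shows "scalar_curvature \<A> g D p = ricci \<A> D p (\<xi> p) (\<xi> p)
    + (ricci \<A> D p a b + ricci \<A> D p b a) / g p a b"
  unfolding scalar_curvature_def using null_pairD(1,2)[OF assms(1)]
  by (subst trace_tangent[OF assms]) (simp_all add: Q_add Q_scale g_Q flip: g_\<xi>)

section \<open>Covariant derivatives of \<xi> and the contact distribution\<close>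

lemma \<eta>_connection_\<xi>:
  assumes "X \<in> \<X>"
  shows "\<eta> p (D X \<xi> p) = 0"
proof -
  have "X p (\<lambda>q. g q (\<xi> q) (\<xi> q)) = g p (D X \<xi> p) (\<xi> p) + g p (\<xi> p) (D X \<xi> p)"
    using assms by (intro metric_compatible) simp_all
  moreover have "X p (\<lambda>q. g q (\<xi> q) (\<xi> q)) = 0"
    using assms tangent_const[of "X p" p] by (simp add: g_\<xi>)
  ultimately show ?thesis
    using assms by (simp add: g_\<xi> g_\<xi>')
qed

text \<open>The contact condition with first argument \<xi> has right-hand side 0, so the derivative
  of \<eta>(Y) along \<xi> is \<eta> of the bracket, that is, of \<open>D \<xi> Y\<close>. Metric
  compatibility gives the same plus the product of \<open>D \<xi> \<xi>\<close> with Y, which must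
  therefore vanish.\<close>

lemma connection_\<xi>_\<xi>: "D \<xi> \<xi> = 0"
proof
  fix p
  have "g p (D \<xi> \<xi> p) y = 0" if y: "y \<in> \<T> p" for y
  proof -
    obtain Y where Y: "Y \<in> \<X>" "Y p = y"
      using extension_exists[OF y] by blast
    have "\<xi> p (\<lambda>q. g q (\<xi> q) (Y q)) = g p (D \<xi> \<xi> p) y + \<eta> p (D \<xi> Y p)"
      using Y by (subst metric_compatible) (simp_all add: g_\<xi>')
    moreover have "\<xi> p (\<lambda>q. \<eta> q (Y q)) = \<eta> p (lie_bracket \<xi> Y p)"
      using contact[of \<xi> Y p] Y y tangent_const[of "Y p" p 1] by (simp add: g_\<xi>' \<eta>_\<phi>)
    moreover have "\<eta> p (lie_bracket \<xi> Y p) = \<eta> p (D \<xi> Y p)"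
      using Y by (simp add: bracket_eq \<eta>_diff \<eta>_connection_\<xi>)
    ultimately show ?thesis
      using Y by (simp add: g_\<xi>')
  qed
  then show "D \<xi> \<xi> p = 0 p"
    using g_nondegenerate[of "D \<xi> \<xi> p" p] by simp
qed

lemma \<eta>_connection_horizontal:
  assumes "X \<in> \<X>" "W \<in> \<X>" "\<And>q. \<eta> q (X q) = 0"
  shows "\<eta> p (D W X p) = - g p (X p) (D W \<xi> p)"
proof -
  have "W p (\<lambda>q. g q (X q) (\<xi> q)) = g p (D W X p) (\<xi> p) + g p (X p) (D W \<xi> p)"
    using assms by (intro metric_compatible) simp_all
  then show ?thesis
    using assms tangent_const[of "W p" p] by (simp add: g_\<xi>)
qed

lemma cov_deriv_curvature_antisym:
  assumes "W \<in> \<X>" "X \<in> \<X>" "Y \<in> \<X>" "Z \<in> \<X>"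
  shows "cov_deriv_curvature D W Y X Z = - cov_deriv_curvature D W X Y Z"
proof -
  have "D W (R Y X Z) = - D W (R X Y Z)"
    using D_diff2[of W 0 "R X Y Z"] curvature_antisym[of X Y Z] assms by (simp add: D_zero2)
  moreover have "R Y X (D W Z) = - R X Y (D W Z)"
    "R (D W Y) X Z = - R X (D W Y) Z" "R Y (D W X) Z = - R (D W X) Y Z"
    using curvature_antisym[of X Y "D W Z"] curvature_antisym[of X "D W Y" Z]
      curvature_antisym[of "D W X" Y Z] assms by simp_all
  ultimately show ?thesis
    by (simp add: cov_deriv_curvature_def algebra_simps)
qed

lemma Rm_antisym:
  assumes "x \<in> \<T> p" "y \<in> \<T> p" "z \<in> \<T> p" "w \<in> \<T> p"
  shows "Rm p y x z w = - Rm p x y z w"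
  using assms r_antisym[of x p y z] by (simp add: g_neg1)

lemma Rm_self:
  assumes "x \<in> \<T> p" "y \<in> \<T> p" "z \<in> \<T> p"
  shows "Rm p x y z z = 0"
  using r_skew[of x p y z z] assms by simp

lemma Rm_bianchi:
  assumes "x \<in> \<T> p" "y \<in> \<T> p" "z \<in> \<T> p" "w \<in> \<T> p"
  shows "Rm p x y z w + Rm p y z x w + Rm p z x y w = 0"
proof -
  have "g p (r p x y z + r p y z x + r p z x y) w = 0"
    using assms r_bianchi[of x p y z] by (simp add: g_zero1)
  then show ?thesis
    using assms by (simp add: g_add1)
qed

lemma null_pair_derivative_zero:
  assumes ab: "null_pair p a b" "g p a b \<noteq> 0" and x: "x \<in> \<T> p" "\<eta> p x = 0"
    and f: "a f = 0" "b f = 0"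
  shows "x f = 0"
  by (subst null_decomposition[OF ab x(1)]) (simp add: x f scaleR_fun_def)

text \<open>The contact distribution is bracket generating: \<open>\<eta>([P,N]) = 2g(P,N)\<close> for a null frame.\<close>

lemma horizontal_derivative_zero:
  assumes f: "f \<in> \<F>"
    and hor: "\<And>p x. x \<in> \<T> p \<Longrightarrow> \<eta> p x = 0 \<Longrightarrow> x f = 0"
    and x: "x \<in> \<T> p"
  shows "x f = 0"
proof -
  obtain P N where PN: "null_frame P N" "g p (P p) (N p) \<noteq> 0"
    using null_frame_exists .
  have [simp]: "P \<in> \<X>" "N \<in> \<X>"
    using PN(1) by (simp_all add: null_frame_def)
  have "null_pair q (P q) (N q)" for q
    using PN(1) by (simp add: null_frame_def)
  note pn = null_pairD[OF this]
  have 0: "P q f = 0" "N q f = 0" for q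
    using hor[of "P q" q] hor[of "N q" q] pn by simp_all
  have br: "lie_bracket P N p f = 0"
    by (simp add: lie_bracket_def 0 tangent_const[of _ p])
  have \<eta>br: "\<eta> p (lie_bracket P N p) = 2 * g p (P p) (N p)"
    using contact[of P N p] by (simp add: pn tangent_const[of _ p] g_neg2)
  \<comment> \<open>The horizontal part of the bracket. Both it and the whole bracket annihilate
    \<open>f\<close>, hence so does their difference, a nonzero multiple of \<xi> at
    \<open>p\<close>.\<close>
  let ?y = "lie_bracket P N p - (2 * g p (P p) (N p)) *\<^sub>R \<xi> p"
  have "?y \<in> \<T> p" "\<eta> p ?y = 0"
    by (simp_all add: \<eta>_diff \<eta>_scale \<eta>br)
  from hor[OF this] have "\<xi> p f = 0"
    using PN(2) by (simp add: br scaleR_fun_def)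
  moreover have "x - \<eta> p x *\<^sub>R \<xi> p \<in> \<T> p" "\<eta> p (x - \<eta> p x *\<^sub>R \<xi> p) = 0"
    using x by (simp_all add: \<eta>_diff \<eta>_scale)
  from hor[OF this] have "(x - \<eta> p x *\<^sub>R \<xi> p) f = 0" .
  ultimately show ?thesis
    by (simp add: scaleR_fun_def)
qed

end

section \<open>The curvature when the Ricci operator commutes with \<phi>\<close>

locale paracontact3_commuting = paracontact3 \<A> g D \<phi> \<xi> \<eta>
  for \<A> :: "('m::t2_space, 'e::euclidean_space) chart set"
    and g :: "'m \<Rightarrow> 'm tvec \<Rightarrow> 'm tvec \<Rightarrow> real" and D \<phi> \<xi> \<eta> +
  assumes commuting: "x \<in> \<T> p \<Longrightarrow> Q p (\<phi> p x) = \<phi> p (Q p x)"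
begin

text \<open>\<open>Q\<close> maps each eigenspace of \<phi> on ker \<eta> into itself, and such a
  space is null and orthogonal to \<xi>.\<close>

lemma ricci_null_pair:
  assumes "null_pair p a b"
  shows "ricci \<A> D p a a = 0" "ricci \<A> D p a (\<xi> p) = 0"
    "ricci \<A> D p b b = 0" "ricci \<A> D p b (\<xi> p) = 0"
proof -
  note ab = null_pairD[OF assms]
  have a: "\<phi> p (Q p a) = Q p a"
    using commuting[OF ab(1)] ab(5) by simp
  have b: "\<phi> p (Q p b) = - Q p b"
    using commuting[OF ab(2)] ab(2,6) Q_scale[of b p "-1"] by simp
  have "\<eta> p (Q p a) = 0" "\<eta> p (Q p b) = 0"
    using \<eta>_\<phi>[of "Q p a" p] \<eta>_\<phi>[of "Q p b" p] ab a b by (simp_all add: \<eta>_neg)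
  moreover have "g p (Q p a) a = 0" "g p (Q p b) b = 0"
    using g_\<phi>[of "Q p a" p a] g_\<phi>[of "Q p b" p b] ab a b by (simp_all add: g_linear)
  ultimately show "ricci \<A> D p a a = 0" "ricci \<A> D p a (\<xi> p) = 0"
    "ricci \<A> D p b b = 0" "ricci \<A> D p b (\<xi> p) = 0"
    using ab by (simp_all add: g_Q[symmetric] g_\<xi>)
qed

text \<open>The sectional curvature of nondegenerate planes through \<xi>.\<close>

definition "\<kappa> p = ricci \<A> D p (\<xi> p) (\<xi> p) / 2"

text \<open>The sectional curvature of the plane ker \<eta>.\<close>

definition "\<tau> p = scalar_curvature \<A> g D p / 2 - 2 * \<kappa> p"

text \<open>In a null basis each vanishing Ricci component reduces to one curvature component, the
  others having a repeated argument. The Ricci component at \<xi>, \<xi> is a sum of two equal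
  terms, whence the 2 in \<open>\<kappa>_def\<close>; the scalar curvature contains it twice over,
  plus two equal terms for \<tau>.\<close>

lemma
  assumes ab: "null_pair p a b" "g p a b \<noteq> 0"
  shows Rm_\<kappa>: "Rm p a (\<xi> p) (\<xi> p) b = \<kappa> p * g p a b"
    and Rm_\<kappa>': "Rm p b (\<xi> p) (\<xi> p) a = \<kappa> p * g p a b"
    and Rm_\<tau>: "Rm p a b a b = \<tau> p * (g p a b * g p a b)"
    and Rm_zero: "Rm p (\<xi> p) a a (\<xi> p) = 0" "Rm p b a (\<xi> p) a = 0"
      "Rm p (\<xi> p) b b (\<xi> p) = 0" "Rm p a b (\<xi> p) b = 0"
proof -
  note ab' = null_pairD[OF ab(1)]
  have self: "Rm p x x z w = 0" if "x \<in> \<T> p" "z \<in> \<T> p" "w \<in> \<T> p" for x z w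
    using that by (simp add: r_self g_zero1)
  note [simp] = ab'(1,2) self Rm_self
  have ric: "ricci \<A> D p y z = Rm p (\<xi> p) y z (\<xi> p) + (Rm p a y z b + Rm p b y z a) / g p a b"
    if "y \<in> \<T> p" "z \<in> \<T> p" for y z
    by (rule ricci_eq[OF ab that])
  show "Rm p (\<xi> p) a a (\<xi> p) = 0" "Rm p b a (\<xi> p) a = 0"
      "Rm p (\<xi> p) b b (\<xi> p) = 0" "Rm p a b (\<xi> p) b = 0"
    using ricci_null_pair[OF ab(1)] ab(2) by (simp_all add: ric)
  \<comment> \<open>An instance of the pair symmetry, obtained from the first Bianchi identity whose
    third cyclic term has a repeated last argument.\<close>
  have sym: "Rm p b (\<xi> p) (\<xi> p) a = Rm p a (\<xi> p) (\<xi> p) b"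
    using Rm_bianchi[of a p "\<xi> p" b "\<xi> p"] Rm_antisym[of "\<xi> p" p b a "\<xi> p"] r_skew[of a p "\<xi> p" b "\<xi> p"] r_skew[of b p "\<xi> p" a "\<xi> p"]
    by (simp add: g_zero1)
  show k: "Rm p a (\<xi> p) (\<xi> p) b = \<kappa> p * g p a b"
    using ab(2) sym by (simp add: \<kappa>_def ric)
  then show "Rm p b (\<xi> p) (\<xi> p) a = \<kappa> p * g p a b"
    using sym by simp
  have e: "Rm p (\<xi> p) a b (\<xi> p) = \<kappa> p * g p a b" "Rm p (\<xi> p) b a (\<xi> p) = \<kappa> p * g p a b"
    using k sym Rm_antisym[of a p "\<xi> p" b "\<xi> p"] Rm_antisym[of b p "\<xi> p" a "\<xi> p"]
      r_skew[of a p "\<xi> p" b "\<xi> p"] r_skew[of b p "\<xi> p" a "\<xi> p"] by simp_all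
  have "Rm p b a b a = Rm p a b a b"
    using Rm_antisym[of a p b b a] r_skew[of a p b a b] by simp
  then have "scalar_curvature \<A> g D p = 4 * \<kappa> p + 2 * Rm p a b a b / (g p a b * g p a b)"
    using ab(2) by (simp add: scalar_curvature_eq[OF ab] \<kappa>_def[symmetric] ric e field_simps)
      (simp add: \<kappa>_def ric field_simps)
  then show "Rm p a b a b = \<tau> p * (g p a b * g p a b)"
    using ab(2) by (simp add: \<tau>_def add_divide_distrib)
qed

text \<open>Up to antisymmetry in the first two slots this is the complete curvature table on the
  basis. Each vector is rebuilt from its products with \<xi>, \<open>b\<close> and
  \<open>a\<close>.\<close>

lemma
  assumes ab: "null_pair p a b" "g p a b \<noteq> 0"
  shows r_null: "r p (\<xi> p) a (\<xi> p) = - \<kappa> p *\<^sub>R a" "r p (\<xi> p) a a = 0"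
      "r p (\<xi> p) a b = (\<kappa> p * g p a b) *\<^sub>R \<xi> p"
      "r p (\<xi> p) b (\<xi> p) = - \<kappa> p *\<^sub>R b" "r p (\<xi> p) b a = (\<kappa> p * g p a b) *\<^sub>R \<xi> p"
      "r p (\<xi> p) b b = 0"
      "r p a b (\<xi> p) = 0" "r p a b a = (\<tau> p * g p a b) *\<^sub>R a" "r p a b b = - (\<tau> p * g p a b) *\<^sub>R b"
proof -
  note ab' = null_pairD[OF ab(1)]
  note [simp] = ab'(1,2)
  let ?e = "\<xi> p"
  have dec: "r p x y z = Rm p x y z ?e *\<^sub>R ?e + (Rm p x y z b / g p a b) *\<^sub>R a + (Rm p x y z a / g p a b) *\<^sub>R b"
    if "x \<in> \<T> p" "y \<in> \<T> p" "z \<in> \<T> p" for x y z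
    using null_decomposition[OF ab, of "r p x y z"] that by (simp add: g_\<xi>)
  note R = Rm_\<kappa>[OF ab] Rm_\<kappa>'[OF ab] Rm_\<tau>[OF ab] Rm_zero[OF ab]
  have 1: "Rm p ?e a ?e ?e = 0" "Rm p ?e a ?e b = - (\<kappa> p * g p a b)" "Rm p ?e a ?e a = 0"
    using R Rm_antisym[of a p ?e ?e b] Rm_self r_skew[of ?e p a ?e a] by simp_all
  have 2: "Rm p ?e b ?e ?e = 0" "Rm p ?e b ?e a = - (\<kappa> p * g p a b)" "Rm p ?e b ?e b = 0"
    using R Rm_antisym[of b p ?e ?e a] Rm_self r_skew[of ?e p b ?e b] by simp_all
  have 3: "Rm p a b ?e ?e = 0" "Rm p a b ?e a = 0" "Rm p a b ?e b = 0"
    using R Rm_antisym[of b p a ?e a] Rm_self by simp_all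
  \<comment> \<open>The only component here not settled by skewness and the earlier ones is the one
    at \<open>?e a b a\<close>; in its Bianchi sum one other term is in \<open>3\<close> and one has
    equal last arguments.\<close>
  have 4: "Rm p ?e a a ?e = 0" "Rm p ?e a a a = 0" "Rm p ?e a b b = 0" "Rm p ?e a b a = 0"
    "Rm p ?e a a b = 0" "Rm p ?e a b ?e = \<kappa> p * g p a b"
    using R 1 3 Rm_bianchi[of ?e p a b a] Rm_self r_skew[of ?e p a a b] r_skew[of ?e p a b ?e] by simp_all
  have 5: "Rm p ?e b b ?e = 0" "Rm p ?e b b b = 0" "Rm p ?e b a a = 0" "Rm p ?e b a b = 0"
    "Rm p ?e b b a = 0" "Rm p ?e b a ?e = \<kappa> p * g p a b"
    using R 2 3 Rm_bianchi[of ?e p b a b] Rm_antisym[of a p b ?e b] Rm_self r_skew[of ?e p b a b] r_skew[of ?e p b a ?e]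
    by simp_all
  have 6: "Rm p a b a ?e = 0" "Rm p a b b ?e = 0" "Rm p a b a a = 0" "Rm p a b b b = 0"
    "Rm p a b b a = - (\<tau> p * (g p a b * g p a b))"
    using R 3 Rm_self r_skew[of a p b a ?e] r_skew[of a p b b ?e] r_skew[of a p b b a] by simp_all
  show "r p (\<xi> p) a (\<xi> p) = - \<kappa> p *\<^sub>R a" "r p (\<xi> p) a a = 0"
      "r p (\<xi> p) a b = (\<kappa> p * g p a b) *\<^sub>R \<xi> p"
      "r p (\<xi> p) b (\<xi> p) = - \<kappa> p *\<^sub>R b" "r p (\<xi> p) b a = (\<kappa> p * g p a b) *\<^sub>R \<xi> p"
      "r p (\<xi> p) b b = 0"
      "r p a b (\<xi> p) = 0" "r p a b a = (\<tau> p * g p a b) *\<^sub>R a" "r p a b b = - (\<tau> p * g p a b) *\<^sub>R b"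
    using ab(2) by ((subst dec; simp add: 1 2 3 4 5 6 R(3))+)
qed

definition model_curvature :: "'m \<Rightarrow> 'm tvec \<Rightarrow> 'm tvec \<Rightarrow> 'm tvec \<Rightarrow> 'm tvec"
  where "model_curvature p x y z = \<tau> p *\<^sub>R (g p y z *\<^sub>R x - g p x z *\<^sub>R y) +
    (\<kappa> p - \<tau> p) *\<^sub>R ((g p y z * \<eta> p x - g p x z * \<eta> p y) *\<^sub>R \<xi> p
      + (\<eta> p y * \<eta> p z) *\<^sub>R x - (\<eta> p x * \<eta> p z) *\<^sub>R y)"

text \<open>The difference \<open>d\<close> is trilinear and vanishes on all basis triples by the
  table; \<open>d1\<close> and \<open>d2\<close> release the slots one at a time, starting from the
  last.\<close>

lemma curvature_eq_model:
  assumes xyz: "x \<in> \<T> p" "y \<in> \<T> p" "z \<in> \<T> p"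
  shows "r p x y z = model_curvature p x y z"
proof -
  obtain a b where ab: "null_pair p a b" "g p a b \<noteq> 0"
    using null_basis_exists null_basis_nondegenerate by metis
  note ab' = null_pairD[OF ab(1)]
  have \<xi>\<xi>: "g p (\<xi> p) (\<xi> p) = 1"
    by (simp add: g_\<xi>)
  define d where "d x y z = r p x y z - model_curvature p x y z" for x y z
  have lin: "d (x + w) y z = d x y z + d w y z" "d x (y + w) z = d x y z + d x w z"
    "d x y (z + w) = d x y z + d x y w" "d (t *\<^sub>R x) y z = t *\<^sub>R d x y z"
    "d x (t *\<^sub>R y) z = t *\<^sub>R d x y z" "d x y (t *\<^sub>R z) = t *\<^sub>R d x y z"
    if "x \<in> \<T> p" "y \<in> \<T> p" "z \<in> \<T> p" "w \<in> \<T> p" for x y z w t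
    using that
    by (simp_all add: d_def model_curvature_def r_linear g_linear \<eta>_add \<eta>_scale algebra_simps)
  have e: "\<xi> p \<in> \<T> p" by simp
  note r' = r_null[OF ab] r_antisym[OF e ab'(1)] r_antisym[OF e ab'(2)] r_antisym[OF ab'(1,2)]
    r_self[OF e] r_self[OF ab'(1)] r_self[OF ab'(2)]
  have base: "d x y z = 0" if "x \<in> {\<xi> p, a, b}" "y \<in> {\<xi> p, a, b}" "z \<in> {\<xi> p, a, b}" for x y z
    using that ab' \<xi>\<xi> by (auto simp: d_def model_curvature_def r' algebra_simps)
  have mem: "x \<in> \<T> p" if "x \<in> {\<xi> p, a, b}" for x
    using that ab' by auto
  note ext = linear_zero_on_basis[OF ab]
  have d1: "d x y z = 0" if "x \<in> {\<xi> p, a, b}" "y \<in> {\<xi> p, a, b}" "z \<in> \<T> p" for x y z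
    by (rule ext[of "\<lambda>z. d x y z"]) (simp_all add: lin base[OF that(1,2)] that(3) mem[OF that(1)] mem[OF that(2)])
  have d2: "d x y z = 0" if "x \<in> {\<xi> p, a, b}" "y \<in> \<T> p" "z \<in> \<T> p" for x y z
    by (rule ext[of "\<lambda>y. d x y z"]) (simp_all add: lin d1[OF that(1)] that(2,3) mem[OF that(1)])
  have "d x y z = 0"
    by (rule ext[of "\<lambda>x. d x y z"]) (simp_all add: lin d2 xyz)
  then show ?thesis
    by (simp add: d_def)
qed

section \<open>Derivatives of \<kappa> and \<tau>\<close>

lemma curvature_model:
  "X \<in> \<X> \<Longrightarrow> Y \<in> \<X> \<Longrightarrow> Z \<in> \<X> \<Longrightarrow> R X Y Z p = model_curvature p (X p) (Y p) (Z p)"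
  using curvature_eq_model[of "X p" p "Y p" "Z p"] by (simp add: curvature_at_eq)

text \<open>The definition passes through a trace in a basis chosen separately at each point, so
  smoothness must be read off a curvature component along global fields.\<close>

lemma \<kappa>_smooth: "\<kappa> \<in> \<F>"
proof (rule smooth_divide_local)
  fix p
  obtain P N where PN: "null_frame P N" "g p (P p) (N p) \<noteq> 0"
    using null_frame_exists .
  have [simp]: "P \<in> \<X>" "N \<in> \<X>"
    using PN(1) by (simp_all add: null_frame_def)
  define \<rho> where "\<rho> q = g q (P q) (N q)" for q
  \<comment> \<open>\<open>Rm_\<kappa>\<close> requires a nondegenerate pair; the additional factor
    \<rho> makes the equation trivial at the remaining points.\<close>
  have "\<rho> q * \<rho> q * \<kappa> q = \<rho> q * g q (R P \<xi> \<xi> q) (N q)" for q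
    using PN(1) Rm_\<kappa>[of q "P q" "N q"] curvature_at_eq[of P \<xi> \<xi> q]
    by (cases "\<rho> q = 0") (simp_all add: \<rho>_def null_frame_def)
  then have "(\<lambda>q. \<rho> q * \<rho> q * \<kappa> q) = (\<lambda>q. \<rho> q * g q (R P \<xi> \<xi> q) (N q))"
    by blast
  moreover have "\<rho> \<in> \<F>" "(\<lambda>q. \<rho> q * g q (R P \<xi> \<xi> q) (N q)) \<in> \<F>"
    by (simp_all add: \<rho>_def[abs_def] smooth_mult)
  ultimately show "\<exists>\<sigma>\<in>\<F>. \<sigma> p \<noteq> 0 \<and> (\<lambda>q. \<sigma> q * \<kappa> q) \<in> \<F>"
    using PN(2) by (intro bexI[of _ "\<lambda>q. \<rho> q * \<rho> q"]) (simp_all add: smooth_mult \<rho>_def)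
qed

lemma \<tau>_smooth: "\<tau> \<in> \<F>"
proof (rule smooth_divide_local)
  fix p
  obtain P N where PN: "null_frame P N" "g p (P p) (N p) \<noteq> 0"
    using null_frame_exists .
  have [simp]: "P \<in> \<X>" "N \<in> \<X>"
    using PN(1) by (simp_all add: null_frame_def)
  define \<rho> where "\<rho> q = g q (P q) (N q)" for q
  \<comment> \<open>Two factors come from \<open>Rm_\<tau>\<close>; the third covers the zeros of
    \<rho>.\<close>
  have "\<rho> q * (\<rho> q * \<rho> q) * \<tau> q = \<rho> q * g q (R P N P q) (N q)" for q
    using PN(1) Rm_\<tau>[of q "P q" "N q"] curvature_at_eq[of P N P q]
    by (cases "\<rho> q = 0") (simp_all add: \<rho>_def null_frame_def)
  then have "(\<lambda>q. \<rho> q * (\<rho> q * \<rho> q) * \<tau> q) = (\<lambda>q. \<rho> q * g q (R P N P q) (N q))"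
    by blast
  moreover have "\<rho> \<in> \<F>" "(\<lambda>q. \<rho> q * g q (R P N P q) (N q)) \<in> \<F>"
    by (simp_all add: \<rho>_def[abs_def] smooth_mult)
  ultimately show "\<exists>\<sigma>\<in>\<F>. \<sigma> p \<noteq> 0 \<and> (\<lambda>q. \<sigma> q * \<tau> q) \<in> \<F>"
    using PN(2) by (intro bexI[of _ "\<lambda>q. \<rho> q * (\<rho> q * \<rho> q)"]) (simp_all add: smooth_mult \<rho>_def)
qed

text \<open>As \<open>R X \<xi> \<xi>\<close> is \<kappa> times \<open>X\<close>, the correction
  terms cancel \<kappa> times \<open>D W X\<close> up to multiples of \<xi>, and those cancel
  because differentiating the orthogonality of \<open>X\<close> and \<xi> relates
  \<open>D W X\<close> to \<open>D W \<xi>\<close>.\<close>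

lemma cov_deriv_curvature_\<xi>:
  assumes [simp]: "W \<in> \<X>" "X \<in> \<X>" and hor: "\<And>q. \<eta> q (X q) = 0"
  shows "cov_deriv_curvature D W X \<xi> \<xi> p = W p \<kappa> *\<^sub>R X p"
proof -
  have \<xi>\<xi>: "g q (\<xi> q) (\<xi> q) = 1" for q
    by (simp add: g_\<xi>)
  have "R X \<xi> \<xi> = (\<lambda>q. \<kappa> q *\<^sub>R X q)"
    by (rule ext) (simp add: curvature_model model_curvature_def g_\<xi> g_\<xi>' hor algebra_simps)
  then have "D W (R X \<xi> \<xi>) p = W p \<kappa> *\<^sub>R X p + \<kappa> p *\<^sub>R D W X p"
    by (simp add: D_scale2 \<kappa>_smooth)
  moreover have "R (D W X) \<xi> \<xi> p = \<kappa> p *\<^sub>R (D W X p - \<eta> p (D W X p) *\<^sub>R \<xi> p)"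
    by (simp add: curvature_model model_curvature_def g_\<xi> g_\<xi>' algebra_simps)
  moreover have "R X (D W \<xi>) \<xi> p = 0"
    by (simp add: curvature_model model_curvature_def g_\<xi> g_\<xi>' \<eta>_connection_\<xi> hor)
  moreover have "R X \<xi> (D W \<xi>) p = - (\<kappa> p * g p (X p) (D W \<xi> p)) *\<^sub>R \<xi> p"
    by (simp add: curvature_model model_curvature_def g_\<xi> g_\<xi>' \<eta>_connection_\<xi> hor algebra_simps)
  ultimately show ?thesis
    by (simp add: cov_deriv_curvature_def \<eta>_connection_horizontal[OF assms(2,1) hor] algebra_simps)
qed

text \<open>In the Bianchi identity the term differentiated along \<xi> drops out: curvature of two
  horizontal vectors kills \<xi>, and \<open>D \<xi> P\<close> and \<open>D \<xi> N\<close> stay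
  horizontal because \<open>D \<xi> \<xi>\<close> is 0. The other two terms are derivatives of
  \<kappa> times \<open>N\<close> and \<open>P\<close>.\<close>

lemma horizontal_derivative_\<kappa>:
  assumes "x \<in> \<T> p" "\<eta> p x = 0"
  shows "x \<kappa> = 0"
proof -
  obtain P N where PN: "null_frame P N" "g p (P p) (N p) \<noteq> 0"
    using null_frame_exists .
  have [simp]: "P \<in> \<X>" "N \<in> \<X>"
    using PN(1) by (simp_all add: null_frame_def)
  have pnq: "null_pair q (P q) (N q)" for q
    using PN(1) by (simp add: null_frame_def)
  note pn = null_pairD[OF pnq]
  have "R P N \<xi> = 0"
    by (rule ext) (simp add: curvature_model model_curvature_def g_\<xi> g_\<xi>' pn)
  then have "cov_deriv_curvature D \<xi> P N \<xi> p = 0"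
    by (simp add: cov_deriv_curvature_def D_zero2 connection_\<xi>_\<xi> curvature_model model_curvature_def
        g_\<xi> g_\<xi>' g_linear pn \<eta>_connection_horizontal)
  moreover have "cov_deriv_curvature D P N \<xi> \<xi> p = P p \<kappa> *\<^sub>R N p"
    by (rule cov_deriv_curvature_\<xi>) (simp_all add: pn)
  moreover have "cov_deriv_curvature D N \<xi> P \<xi> p = - (N p \<kappa> *\<^sub>R P p)"
    using cov_deriv_curvature_antisym[of N P \<xi> \<xi>] cov_deriv_curvature_\<xi>[of N P p] by (simp add: pn)
  moreover have "(cov_deriv_curvature D \<xi> P N \<xi> + cov_deriv_curvature D P N \<xi> \<xi>
      + cov_deriv_curvature D N \<xi> P \<xi>) p = 0 p"
    by (subst second_bianchi) simp_all
  ultimately have z: "P p \<kappa> *\<^sub>R N p - N p \<kappa> *\<^sub>R P p = 0"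
    by simp
  \<comment> \<open>As \<open>P\<close> and \<open>N\<close> are null, pairing with either keeps
    just one of the two terms.\<close>
  have "g p (P p \<kappa> *\<^sub>R N p - N p \<kappa> *\<^sub>R P p) (P p) = 0" "g p (P p \<kappa> *\<^sub>R N p - N p \<kappa> *\<^sub>R P p) (N p) = 0"
    unfolding z by (simp_all add: g_zero1)
  then have "P p \<kappa> = 0" "N p \<kappa> = 0"
    using PN(2) by (simp_all add: g_linear pn)
  then show ?thesis
    using null_pair_derivative_zero[OF pnq PN(2) assms] by simp
qed

lemma derivative_\<kappa>: "x \<in> \<T> p \<Longrightarrow> x \<kappa> = 0"
  by (rule horizontal_derivative_zero[OF \<kappa>_smooth]) (rule horizontal_derivative_\<kappa>)

text \<open>The tensor behind \<open>V\<close> is built from the metric and hence parallel, so only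
  the derivative of \<tau> survives from it. The \<eta>-part of the curvature vanishes on horizontal
  arguments, and its correction terms yield multiples of \<xi>; \<open>s\<close> is left unspecified
  because \<phi> kills \<xi>.\<close>

lemma cov_deriv_curvature_horizontal:
  assumes [simp]: "W \<in> \<X>" "X \<in> \<X>" "Y \<in> \<X>" "Z \<in> \<X>"
    and hor: "\<And>q. \<eta> q (X q) = 0" "\<And>q. \<eta> q (Y q) = 0" "\<And>q. \<eta> q (Z q) = 0"
  shows "\<exists>s. cov_deriv_curvature D W X Y Z p =
    W p \<tau> *\<^sub>R (g p (Y p) (Z p) *\<^sub>R X p - g p (X p) (Z p) *\<^sub>R Y p) + s *\<^sub>R \<xi> p"
proof -
  define V where "V = (\<lambda>q. g q (Y q) (Z q) *\<^sub>R X q) - (\<lambda>q. g q (X q) (Z q) *\<^sub>R Y q)"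
  have [simp]: "V \<in> \<X>"
    by (simp add: V_def)
  have Vp: "V p = g p (Y p) (Z p) *\<^sub>R X p - g p (X p) (Z p) *\<^sub>R Y p"
    by (simp add: V_def)
  have DV: "D W V p = (g p (D W Y p) (Z p) + g p (Y p) (D W Z p)) *\<^sub>R X p + g p (Y p) (Z p) *\<^sub>R D W X p
      - ((g p (D W X p) (Z p) + g p (X p) (D W Z p)) *\<^sub>R Y p + g p (X p) (Z p) *\<^sub>R D W Y p)"
    by (simp add: V_def D_diff2 D_scale2 metric_compatible)
  have "R X Y Z = (\<lambda>q. \<tau> q *\<^sub>R V q)"
    by (rule ext) (simp add: curvature_model model_curvature_def V_def hor)
  then have DR: "D W (R X Y Z) p = W p \<tau> *\<^sub>R V p + \<tau> p *\<^sub>R D W V p"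
    by (simp add: D_scale2 \<tau>_smooth)
  define s where
    "s = (\<kappa> p - \<tau> p) * (g p (X p) (Z p) * \<eta> p (D W Y p) - g p (Y p) (Z p) * \<eta> p (D W X p))"
  have "cov_deriv_curvature D W X Y Z p = W p \<tau> *\<^sub>R V p + s *\<^sub>R \<xi> p"
    by (simp add: cov_deriv_curvature_def s_def DR DV curvature_model model_curvature_def hor algebra_simps)
  then show ?thesis
    unfolding Vp by (rule exI[of _ s])
qed

section \<open>Local \<phi>-symmetry and constant scalar curvature\<close>

lemma locally_phi_symmetric_iff:
  assumes "connected (UNIV :: 'm set)"
  shows "locally_phi_symmetric \<A> \<phi> \<xi> g D \<longleftrightarrow> scalar_curvature \<A> g D constant_on UNIV"
proof
  assume "scalar_curvature \<A> g D constant_on UNIV"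
  then obtain K where K: "scalar_curvature \<A> g D p = K" for p
    unfolding constant_on_def by blast
  have \<tau>: "\<tau> = (\<lambda>q. K / 2 - 2 * \<kappa> q)"
    by (simp add: \<tau>_def[abs_def] K)
  \<comment> \<open>With constant scalar curvature \<tau> is a constant minus
    \<open>2 * \<kappa> q\<close>, and the derivative of \<kappa> is already known to be 0.\<close>
  have d\<tau>: "x \<tau> = 0" if "x \<in> \<T> p" for x p
    unfolding \<tau> using \<kappa>_smooth
    by (simp add: tangent_diff[OF that] tangentD(3)[OF that] smooth_mult tangent_const[OF that]
        derivative_\<kappa>[OF that])
  show "locally_phi_symmetric \<A> \<phi> \<xi> g D"
    unfolding locally_phi_symmetric_def
  proof (intro ballI impI allI)
    fix W X Y Z p
    assume f: "W \<in> \<X>" "X \<in> \<X>" "Y \<in> \<X>" "Z \<in> \<X>"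
      and "\<forall>p. g p (W p) (\<xi> p) = 0 \<and> g p (X p) (\<xi> p) = 0 \<and> g p (Y p) (\<xi> p) = 0 \<and> g p (Z p) (\<xi> p) = 0"
    then have "\<eta> q (X q) = 0" "\<eta> q (Y q) = 0" "\<eta> q (Z q) = 0" for q
      by (simp_all add: g_\<xi>)
    then obtain s where "cov_deriv_curvature D W X Y Z p = W p \<tau> *\<^sub>R (g p (Y p) (Z p) *\<^sub>R X p
        - g p (X p) (Z p) *\<^sub>R Y p) + s *\<^sub>R \<xi> p"
      using cov_deriv_curvature_horizontal f by metis
    then show "\<phi> p (\<phi> p (cov_deriv_curvature D W X Y Z p)) = 0"
      using f by (simp add: d\<tau>[of _ p] \<phi>_scale)
  qed
next
  assume sym: "locally_phi_symmetric \<A> \<phi> \<xi> g D"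
  have "x \<tau> = 0" if x: "x \<in> \<T> p" "\<eta> p x = 0" for x p
  proof -
    obtain P N where PN: "null_frame P N" "g p (P p) (N p) \<noteq> 0"
      using null_frame_exists .
    have [simp]: "P \<in> \<X>" "N \<in> \<X>"
      using PN(1) by (simp_all add: null_frame_def)
    have pnq: "null_pair q (P q) (N q)" for q
      using PN(1) by (simp add: null_frame_def)
    note pn = null_pairD[OF pnq]
    have W: "W p \<tau> = 0" if "W = P \<or> W = N" for W
    proof -
      have [simp]: "W \<in> \<X>" and "\<And>q. g q (W q) (\<xi> q) = 0"
        using that by (auto simp: pn)
      \<comment> \<open>The triple \<open>P, N, N\<close> isolates one term: \<open>N\<close> is
        null, \<phi> applied twice fixes \<open>N\<close> and kills \<xi>, so a multiple of
        \<open>N\<close> with a nonzero factor next to the derivative of \<tau> is left.\<close>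
      then have "\<phi> p (\<phi> p (cov_deriv_curvature D W P N N p)) = 0"
        using sym by (simp add: locally_phi_symmetric_def pn)
      moreover obtain s where "cov_deriv_curvature D W P N N p =
          W p \<tau> *\<^sub>R (g p (N p) (N p) *\<^sub>R P p - g p (P p) (N p) *\<^sub>R N p) + s *\<^sub>R \<xi> p"
        using cov_deriv_curvature_horizontal[of W P N N p] by (auto simp: pn)
      ultimately have "(W p \<tau> * g p (P p) (N p)) *\<^sub>R N p = 0"
        by (simp add: pn \<phi>_add \<phi>_diff \<phi>_scale \<phi>_neg)
      moreover have "N p \<noteq> 0"
        using PN(2) g_zero2[of "P p" p] by auto
      ultimately show ?thesis
        using PN(2) by simp
    qed
    show ?thesis
      using null_pair_derivative_zero[OF pnq PN(2) x] W by simp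
  qed
  then have d\<tau>: "x \<tau> = 0" if "x \<in> \<T> p" for x p
    using horizontal_derivative_zero[OF \<tau>_smooth] that by blast
  have s: "scalar_curvature \<A> g D = (\<lambda>q. 2 * \<tau> q + 4 * \<kappa> q)"
    by (simp add: \<tau>_def fun_eq_iff)
  show "scalar_curvature \<A> g D constant_on UNIV"
  proof (rule constant_if_derivatives_zero[OF _ _ assms])
    show "scalar_curvature \<A> g D \<in> \<F>"
      unfolding s by (intro smooth_add smooth_mult smooth_const \<tau>_smooth \<kappa>_smooth)
    show "x (scalar_curvature \<A> g D) = 0" if "x \<in> \<T> p" for p x
      unfolding s using \<tau>_smooth \<kappa>_smooth
      by (simp add: tangentD(1,3)[OF that] smooth_mult d\<tau>[OF that] derivative_\<kappa>[OF that])
  qed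
qed

end

theorem theorem4p11:
  fixes \<A> :: "('m::{t2_space,second_countable_topology}, real ^ 3) chart set"
    and \<phi> :: "'m \<Rightarrow> 'm tvec \<Rightarrow> 'm tvec"
    and \<xi> :: "'m vfield"
    and \<eta> :: "'m \<Rightarrow> 'm tvec \<Rightarrow> real"
    and g :: "'m \<Rightarrow> 'm tvec \<Rightarrow> 'm tvec \<Rightarrow> real"
    and D :: "'m vfield \<Rightarrow> 'm vfield \<Rightarrow> 'm vfield"
  assumes "smooth_atlas \<A>"
    and "connected (UNIV :: 'm set)"
    and "paracontact_metric_structure 1 \<A> \<phi> \<xi> \<eta> g"
    and "levi_civita_connection \<A> g D"
    and "\<forall>p. \<forall>x\<in>tangent_space \<A> p.
           ricci_operator \<A> g D p (\<phi> p x) = \<phi> p (ricci_operator \<A> g D p x)"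
  shows "locally_phi_symmetric \<A> \<phi> \<xi> g D \<longleftrightarrow>
    scalar_curvature \<A> g D constant_on UNIV"
proof -
  have "pseudo_riemannian_metric \<A> g"
    using assms(3) by (simp add: paracontact_metric_structure_def compatible_metric_def)
  then interpret paracontact3_commuting \<A> g D \<phi> \<xi> \<eta>
    using assms by unfold_locales auto
  show ?thesis
    by (rule locally_phi_symmetric_iff[OF assms(2)])
qed

end
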